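(* Let $m>0$, $0<q<1$, let $u_0\ge 0$ be continuous on $\mathbb{R}$ with compact support $[-s_0,s_0]$, and let $(u_h^n)$ be the numerical solution defined in the context, with $v_h^n$ the piecewise constant derivative of $u_h^n$. Put $T_1=\frac{1}{mq\|u_h^0\|_\infty^q}$ (read as $+\infty$ if $u_h^0\equiv0$). Suppose that the stability condition $$\frac{\Delta t_n}{h}\|v_h^n\|_\infty\le\frac m2$$ is satisfied at each step. Then $$\|v_h^n\|_1\le C\qquad\text{for } t_n<T<T_1,$$ where $C$ is a constant depending on $T$ and $u_0$ (the parameters $m,q$ being fixed).
   Context: **Problem.** $m>0$, $0<q<1$; the Cauchy problem is $u_t-\frac1m u_x^2-u\,u_{xx}=m\,u^{q+1}$ on $\mathbb{R}\times(0,\infty)$, $u(\cdot,0)=u_0$. Norms $\|\cdot\|_s$ are those of $L^s(\mathbb{R})$. **Mesh and spaces.** Let $N\in\mathbb{N}$, $h=s_0/N$, $x_i=ih$ ($i\in\mathbb{Z}$), $I_i=(x_{i-1},x_i)$. Let $\Delta t_n>0$ be the time steps, $t_0=0$, $t_{n+1}=t_n+\Delta t_n$. At level $n$ there is an interval $[-s_-^n,s_+^n]$, with $s_\pm^0=s_0$; put $N_\pm^n=\lfloor s_\pm^n/h\rfloor$ and $h_\pm^n=s_\pm^n-(N_\pm^n-1)h$, so $h\le h_\pm^n<2h$. $V_h^n$ is the space of continuous functions on $\mathbb{R}$ that vanish outside $(-s_-^n,s_+^n)$ and are affine on each $I_i$, $-N_-^n+2\le i\le N_+^n-1$, and on the two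 end intervals $(-s_-^n,x_{-N_-^n+1})$ and $(x_{N_+^n-1},s_+^n)$. $\pi_h^n$ is Lagrange interpolation into $V_h^n$ at the nodes $x_i$, $-N_-^n+1\le i\le N_+^n-1$. Write $\phi_i=\phi_h(x_i)$. **Scheme.** $u_h^0=\pi_h^0u_0$. Given $u_h^n\in V_h^n$, its piecewise constant derivative $v_h^n$ is: $v_i^n=(u_i^n-u_{i-1}^n)/h$ on $I_i$ for $-N_-^n+2\le i\le N_+^n-1$, $v^n_{N_+^n}=-u^n_{N_+^n-1}/h_+^n$ on the right end interval, $v^n_{-N_-^n+1}=u^n_{-N_-^n+1}/h_-^n$ on the left end interval, and zero outside $(-s_-^n,s_+^n)$. (1) Hyperbolic step, for $u_t=\frac1m u_x^2$, solved exactly by the Hopf–Lax formula: $u^{n+1/2}(x)=\sup_{y\in\mathbb{R}}\{u_h^n(y)-\frac{m(x-y)^2}{4\Delta t_n}\}$; $s_+^{n+1}=s_+^n-\frac{\Delta t_n}{m}v^n_{N_+^n}$, $s_-^{n+1}=s_-^n+\frac{\Delta t_n}{m}v^n_{-N_-^n+1}$; $u_h^{n+1/2}=\pi_h^{n+1}u^{n+1/2}\in V_h^{n+1}$. (2) Parabolic step, for $u_t-u\,u_{xx}=mu^{q+1}$: $u_h^{n+1}\in V_h^{n+1}$ is the solution of, for all $\phi_h\in V_h^{n+1}$, $$(u_h^{n+1},\phi_h)_h+\Delta t_n\big((u_h^{n+1})_x,(u_h^{n+1/2}\phi_h)_x\big)=(u_h^{n+1/2},\phi_h)_h+mq\Delta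 t_n\big(\pi_h^{n+1}((u_h^{n+1/2})^qu_h^{n+1}),\phi_h\big)_h+m(1-q)\Delta t_n\big(\pi_h^{n+1}((u_h^{n+1/2})^{q+1}),\phi_h\big)_h,$$ where $(\cdot,\cdot)$ is the $L^2(\mathbb{R})$ scalar product and, with $a=-N_-^{n+1}+1$, $b=N_+^{n+1}-1$, $$(\phi_h,\psi_h)_h=\tfrac12(h_-^{n+1}+h)\phi_a\psi_a+h\sum_{i=a+1}^{b-1}\phi_i\psi_i+\tfrac12(h_+^{n+1}+h)\phi_b\psi_b .$$ Under the stability condition, this step has a unique solution, which is nonnegative, when $mq\Delta t_n\|u_h^{n+1/2}\|_\infty^q<1$; this holds automatically as long as $t_{n+1}<T_1$, because $\|u_h^{n+1/2}\|_\infty\le\|u_h^n\|_\infty\le\|u_h^0\|_\infty\,(1-mqt_n\|u_h^0\|_\infty^q)^{-1/q}$.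
   Formalization: C is independent of h only if u_0 has bounded variation (else false at n=0 as h→0), uniformly over meshes with T_1 ≥ S for a fixed S > T (this misses only T = 1/(mq‖u_0‖^q)); for general continuous u_0, C may depend on h. *)

theory Defs
  imports "HOL-Analysis.Analysis" "HOL-Probability.Essential_Supremum"
begin

text \<open>Norms of \<open>L\<^sup>1\<close> and \<open>L\<^sup>\<infinity>\<close> over the real line with Lebesgue measure. They are real-valued:
  every function they are applied to below is bounded and Borel with bounded support, so the
  totalised value for a non-integrable or essentially unbounded argument never occurs.\<close>

definition L1_norm :: "(real \<Rightarrow> real) \<Rightarrow> real" where
  "L1_norm f = (LINT x|lborel. \<bar>f x\<bar>)"

definition Linf_norm :: "(real \<Rightarrow> real) \<Rightarrow> real" where
  "Linf_norm f = real_of_ereal (esssup lborel (\<lambda>x. ereal \<bar>f x\<bar>))"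

definition bounded_variation :: "(real \<Rightarrow> real) \<Rightarrow> bool" where
  "bounded_variation f \<longleftrightarrow>
     (\<exists>V. \<forall>(p :: nat \<Rightarrow> real) k. mono p \<longrightarrow> (\<Sum>i<k. \<bar>f (p (Suc i)) - f (p i)\<bar>) \<le> V)"

text \<open>A level of the scheme is given by the mesh size \<open>h\<close> and the numbers \<open>sm\<close>, \<open>sp\<close> standing
  for \<open>s\<^sub>-\<close>, \<open>s\<^sub>+\<close>; the nodes are the \<open>x\<^sub>i = i h\<close> with \<open>first_node h sm \<le> i \<le> last_node h sp\<close>.
  The definition of \<open>end_length\<close> serves both \<open>h\<^sub>-\<close> (from \<open>sm\<close>) and \<open>h\<^sub>+\<close> (from \<open>sp\<close>).\<close>

definition node :: "real \<Rightarrow> int \<Rightarrow> real" where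
  "node h i = of_int i * h"

definition end_index :: "real \<Rightarrow> real \<Rightarrow> int" where
  "end_index h s = \<lfloor>s / h\<rfloor>"

definition end_length :: "real \<Rightarrow> real \<Rightarrow> real" where
  "end_length h s = s - (of_int (end_index h s) - 1) * h"

definition first_node :: "real \<Rightarrow> real \<Rightarrow> int" where
  "first_node h sm = - end_index h sm + 1"

definition last_node :: "real \<Rightarrow> real \<Rightarrow> int" where
  "last_node h sp = end_index h sp - 1"

definition affine_fun_on :: "real set \<Rightarrow> (real \<Rightarrow> real) \<Rightarrow> bool" where
  "affine_fun_on S f \<longleftrightarrow> (\<exists>\<alpha> \<beta>. \<forall>x\<in>S. f x = \<alpha> * x + \<beta>)"

definition Vh :: "real \<Rightarrow> real \<Rightarrow> real \<Rightarrow> (real \<Rightarrow> real) set" where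
  "Vh h sm sp = {\<phi>. continuous_on UNIV \<phi> \<and>
     (\<forall>x. x \<notin> {-sm<..<sp} \<longrightarrow> \<phi> x = 0) \<and>
     (\<forall>i \<in> {first_node h sm + 1..last_node h sp}.
        affine_fun_on {node h (i - 1)<..<node h i} \<phi>) \<and>
     affine_fun_on {-sm<..<node h (first_node h sm)} \<phi> \<and>
     affine_fun_on {node h (last_node h sp)<..<sp} \<phi>}"

definition interp :: "real \<Rightarrow> real \<Rightarrow> real \<Rightarrow> (real \<Rightarrow> real) \<Rightarrow> real \<Rightarrow> real" where
  "interp h sm sp f = (THE \<phi>. \<phi> \<in> Vh h sm sp \<and>
     (\<forall>i \<in> {first_node h sm..last_node h sp}. \<phi> (node h i) = f (node h i)))"

definition slope_left :: "real \<Rightarrow> real \<Rightarrow> (real \<Rightarrow> real) \<Rightarrow> real" where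
  "slope_left h sm u = u (node h (first_node h sm)) / end_length h sm"

definition slope_right :: "real \<Rightarrow> real \<Rightarrow> (real \<Rightarrow> real) \<Rightarrow> real" where
  "slope_right h sp u = - u (node h (last_node h sp)) / end_length h sp"

definition slope :: "real \<Rightarrow> (real \<Rightarrow> real) \<Rightarrow> int \<Rightarrow> real" where
  "slope h u i = (u (node h i) - u (node h (i - 1))) / h"

text \<open>The value at the nodes themselves, a null set, is 0.\<close>

definition vh :: "real \<Rightarrow> real \<Rightarrow> real \<Rightarrow> (real \<Rightarrow> real) \<Rightarrow> real \<Rightarrow> real" where
  "vh h sm sp u x =
     slope_left h sm u * indicator {-sm<..<node h (first_node h sm)} x
     + (\<Sum>i = first_node h sm + 1..last_node h sp.
          slope h u i * indicator {node h (i - 1)<..<node h i} x)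
     + slope_right h sp u * indicator {node h (last_node h sp)<..<sp} x"

definition hopf_lax :: "real \<Rightarrow> real \<Rightarrow> (real \<Rightarrow> real) \<Rightarrow> real \<Rightarrow> real" where
  "hopf_lax m \<tau> u x = (SUP y. u y - m * (x - y)^2 / (4 * \<tau>))"

definition lumped :: "real \<Rightarrow> real \<Rightarrow> real \<Rightarrow> (real \<Rightarrow> real) \<Rightarrow> (real \<Rightarrow> real) \<Rightarrow> real" where
  "lumped h sm sp \<phi> \<psi> =
     (let a = first_node h sm; b = last_node h sp in
        (end_length h sm + h) / 2 * \<phi> (node h a) * \<psi> (node h a)
        + h * (\<Sum>i = a + 1..b - 1. \<phi> (node h i) * \<psi> (node h i))
        + (end_length h sp + h) / 2 * \<phi> (node h b) * \<psi> (node h b))"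

definition L2_inner :: "(real \<Rightarrow> real) \<Rightarrow> (real \<Rightarrow> real) \<Rightarrow> real" where
  "L2_inner f g = (LINT x|lborel. f x * g x)"

text \<open>Here \<open>w\<close> is \<open>u\<^sub>h\<close> at the half level and \<open>u\<close> is \<open>u\<^sub>h\<close> at the new level. The derivatives exist
  except at finitely many points, where the unspecified value of \<^const>\<open>deriv\<close> does not affect
  the integral.\<close>

definition parabolic_step ::
    "real \<Rightarrow> real \<Rightarrow> real \<Rightarrow> real \<Rightarrow> real \<Rightarrow> real \<Rightarrow> (real \<Rightarrow> real) \<Rightarrow> (real \<Rightarrow> real) \<Rightarrow> bool" where
  "parabolic_step m q \<tau> h sm sp w u \<longleftrightarrow>
     u \<in> Vh h sm sp \<and>
     (\<forall>\<phi> \<in> Vh h sm sp.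
        lumped h sm sp u \<phi> + \<tau> * L2_inner (deriv u) (deriv (\<lambda>x. w x * \<phi> x))
        = lumped h sm sp w \<phi>
          + m * q * \<tau> * lumped h sm sp (interp h sm sp (\<lambda>x. w x powr q * u x)) \<phi>
          + m * (1 - q) * \<tau> * lumped h sm sp (interp h sm sp (\<lambda>x. w x powr (q + 1))) \<phi>)"

text \<open>The sequences \<open>sm\<close>, \<open>sp\<close>, \<open>u\<close> are produced by the scheme with time steps \<open>\<tau>\<close> up to level \<open>n\<close>;
  nothing is said about later levels, so solvability beyond level \<open>n\<close> is not presupposed.\<close>

definition numerical_solution ::
    "real \<Rightarrow> real \<Rightarrow> real \<Rightarrow> (real \<Rightarrow> real) \<Rightarrow> real \<Rightarrow> (nat \<Rightarrow> real) \<Rightarrow>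
     (nat \<Rightarrow> real) \<Rightarrow> (nat \<Rightarrow> real) \<Rightarrow> (nat \<Rightarrow> real \<Rightarrow> real) \<Rightarrow> nat \<Rightarrow> bool" where
  "numerical_solution m q s0 u0 h \<tau> sm sp u n \<longleftrightarrow>
     sm 0 = s0 \<and> sp 0 = s0 \<and> u 0 = interp h s0 s0 u0 \<and>
     (\<forall>k<n. \<tau> k > 0 \<and>
        sp (Suc k) = sp k - \<tau> k / m * slope_right h (sp k) (u k) \<and>
        sm (Suc k) = sm k + \<tau> k / m * slope_left h (sm k) (u k) \<and>
        parabolic_step m q (\<tau> k) h (sm (Suc k)) (sp (Suc k))
          (interp h (sm (Suc k)) (sp (Suc k)) (hopf_lax m (\<tau> k) (u k))) (u (Suc k)))"

definition stable ::
    "real \<Rightarrow> real \<Rightarrow> (nat \<Rightarrow> real) \<Rightarrow> (nat \<Rightarrow> real) \<Rightarrow> (nat \<Rightarrow> real) \<Rightarrow>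
     (nat \<Rightarrow> real \<Rightarrow> real) \<Rightarrow> nat \<Rightarrow> bool" where
  "stable m h \<tau> sm sp u n \<longleftrightarrow>
     (\<forall>k<n. \<tau> k / h * Linf_norm (vh h (sm k) (sp k) (u k)) \<le> m / 2)"

definition time :: "(nat \<Rightarrow> real) \<Rightarrow> nat \<Rightarrow> real" where
  "time \<tau> n = (\<Sum>k<n. \<tau> k)"

definition T1 :: "real \<Rightarrow> real \<Rightarrow> (real \<Rightarrow> real) \<Rightarrow> ereal" where
  "T1 m q f = (if f = (\<lambda>x. 0) then \<infinity> else ereal (1 / (m * q * Linf_norm f powr q)))"

text \<open>The bound \<open>\<parallel>v\<^sub>h\<^sup>n\<parallel>\<^sub>1 \<le> C\<close> for \<open>t\<^sub>n < T\<close>, for all stable runs of the scheme with mesh size \<open>h\<close>: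
  a single \<open>C\<close> for all choices of the time steps and all levels.\<close>

definition variation_bound ::
    "real \<Rightarrow> real \<Rightarrow> real \<Rightarrow> (real \<Rightarrow> real) \<Rightarrow> real \<Rightarrow> real \<Rightarrow> real \<Rightarrow> bool" where
  "variation_bound m q s0 u0 h T C \<longleftrightarrow>
     (\<forall>\<tau> sm sp u n.
        numerical_solution m q s0 u0 h \<tau> sm sp u n \<longrightarrow> stable m h \<tau> sm sp u n \<longrightarrow>
        time \<tau> n < T \<longrightarrow> L1_norm (vh h (sm n) (sp n) (u n)) \<le> C)"

end

theory Submission
  imports Defs
begin

text \<open>The sup-convolution in the hyperbolic step does not increase the variation, and neither does
  interpolation. In the parabolic step the second difference has a sign at a discrete extremum, so there the new nodal
  value is on the right side of \<open>g w\<close>, where \<open>w\<close> is the old nodal value and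
  \<open>g w = w (1 + m (1 - q) \<tau> w powr q) / (1 - m q \<tau> w powr q)\<close>.
  This bounds the variation after the step by the variation of \<open>g \<circ> w\<close>, and the sup norm \<open>M\<close> by
  \<open>g M\<close>. Although \<open>w powr q\<close> is not Lipschitz at 0, \<open>g\<close> is Lipschitz on \<open>{0..M}\<close>, with constant
  at most \<open>(1 - A) powr (- 2 / q)\<close> for \<open>A = m q \<tau> M powr q\<close>, and \<open>g M \<le> M (1 - A) powr (- 1 / q)\<close>. With
  the initial sup norm \<open>M\<^sub>0\<close>, \<open>B = m q M\<^sub>0 powr q\<close> and \<open>M = M\<^sub>0 (1 - B t\<^sub>n) powr (- 1 / q)\<close> one has
  \<open>1 - A = (1 - B t\<^bsub>n+1\<^esub>) / (1 - B t\<^sub>n)\<close>, so both products telescope and the variation at time \<open>t\<close> is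
  at most \<open>(1 - B t) powr (- 2 / q)\<close> times the initial one.\<close>

section \<open>Variation of the sup-convolution\<close>

lemma sum_by_parts:
  fixes \<sigma> E :: "nat \<Rightarrow> real"
  shows "(\<Sum>i<Suc n. \<sigma> i * (E (Suc i) - E i)) =
    \<sigma> n * E (Suc n) - \<sigma> 0 * E 0 - (\<Sum>i<n. E (Suc i) * (\<sigma> (Suc i) - \<sigma> i))"
  by (induction n) (simp_all add: algebra_simps)

text \<open>Multiply the increments of \<open>U - G\<close> by the signs of the increments of
  \<open>U\<close> and sum by parts: the sign changes only at discrete extrema of \<open>U\<close>,
  where the hypotheses fix the sign of \<open>U - G\<close>. A flat step counts as rising, so a
  plateau is tested as a maximum only at its last point and as a minimum only at its first.\<close>

lemma variation_comparison:
  fixes U G :: "nat \<Rightarrow> real"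
  assumes ends: "U 0 = G 0" "U n = G n"
    and max: "\<And>i. Suc i < n \<Longrightarrow> U i \<le> U (Suc i) \<Longrightarrow> U (Suc (Suc i)) < U (Suc i) \<Longrightarrow> U (Suc i) \<le> G (Suc i)"
    and min: "\<And>i. Suc i < n \<Longrightarrow> U (Suc i) < U i \<Longrightarrow> U (Suc i) \<le> U (Suc (Suc i)) \<Longrightarrow> G (Suc i) \<le> U (Suc i)"
  shows "(\<Sum>i<n. \<bar>U (Suc i) - U i\<bar>) \<le> (\<Sum>i<n. \<bar>G (Suc i) - G i\<bar>)"
proof (cases n)
  case (Suc k)
  define \<sigma> where "\<sigma> i = (if U i \<le> U (Suc i) then 1 else -1 :: real)" for i
  define E where "E i = U i - G i" for i
  have "E (Suc i) * (\<sigma> (Suc i) - \<sigma> i) \<ge> 0" if "i < k" for i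
    using max[of i] min[of i] that Suc by (auto simp: \<sigma>_def E_def)
  hence "(\<Sum>i<k. E (Suc i) * (\<sigma> (Suc i) - \<sigma> i)) \<ge> 0"
    by (intro sum_nonneg) auto
  hence "(\<Sum>i<n. \<sigma> i * (E (Suc i) - E i)) \<le> 0"
    using ends by (simp only: Suc sum_by_parts) (simp add: E_def)
  moreover have "(\<Sum>i<n. \<bar>U (Suc i) - U i\<bar>) = (\<Sum>i<n. \<sigma> i * (E (Suc i) - E i)) + (\<Sum>i<n. \<sigma> i * (G (Suc i) - G i))"
    unfolding sum.distrib[symmetric] by (intro sum.cong) (auto simp: \<sigma>_def E_def)
  moreover have "(\<Sum>i<n. \<sigma> i * (G (Suc i) - G i)) \<le> (\<Sum>i<n. \<bar>G (Suc i) - G i\<bar>)"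
    by (intro sum_mono) (auto simp: \<sigma>_def)
  ultimately show ?thesis by linarith
qed simp

section \<open>The Hopf-Lax formula and its maximisers\<close>

lemma hopf_lax_attained:
  assumes "m > 0" "\<tau> > 0" and cont: "continuous_on UNIV u" and M: "\<And>x. u x \<le> M"
  obtains y where "hopf_lax m \<tau> u x = u y - m * (x - y)^2 / (4 * \<tau>)"
    "\<And>z. u z - m * (x - z)^2 / (4 * \<tau>) \<le> hopf_lax m \<tau> u x"
proof -
  define f where "f y = u y - m * (x - y)^2 / (4 * \<tau>)" for y
  \<comment> \<open>Since \<open>R \<ge> 1\<close> gives \<open>R^2 \<ge> R\<close>, the penalty at
    distance \<open>R\<close> or more exceeds \<open>M - u x\<close>. No such point beats
    \<open>y = x\<close>, so a compact interval suffices.\<close>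
  define R where "R = 1 + 4 * \<tau> / m * (M - u x)"
  have R: "R \<ge> 1" using assms M[of x] by (simp add: R_def)
  have "continuous_on {x - R..x + R} f"
    unfolding f_def divide_inverse by (intro continuous_intros continuous_on_subset[OF cont]) auto
  then obtain y where y: "y \<in> {x - R..x + R}" "\<forall>z\<in>{x - R..x + R}. f z \<le> f y"
    using continuous_attains_sup[of "{x - R..x + R}" f] R by auto
  have "f z \<le> f y" for z
  proof (cases "z \<in> {x - R..x + R}")
    case False
    hence "\<bar>x - z\<bar> \<ge> R" by auto
    moreover have "R \<le> R^2" using R by (simp add: power2_eq_square)
    ultimately have "(x - z)^2 \<ge> R"
      using R power_mono[of R "\<bar>x - z\<bar>" 2] by simp
    hence "m * (x - z)^2 / (4 * \<tau>) \<ge> m * R / (4 * \<tau>)"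
      using assms by (intro divide_right_mono mult_left_mono) auto
    also have "m * R / (4 * \<tau>) = m / (4 * \<tau>) + (M - u x)"
      using assms by (simp add: R_def field_simps)
    finally have "f z \<le> u x" using M[of z] assms by (simp add: f_def) (smt (verit) divide_pos_pos)
    also have "u x = f x" by (simp add: f_def)
    also have "f x \<le> f y" using y R by auto
    finally show ?thesis .
  qed (use y in auto)
  moreover from this have "hopf_lax m \<tau> u x = f y"
    unfolding hopf_lax_def f_def[symmetric]
    by (intro cSup_eq_maximum) auto
  ultimately show ?thesis using that[of y] by (simp add: f_def)
qed

lemma hopf_lax_bounds:
  assumes "m > 0" "\<tau> > 0" "continuous_on UNIV u" "\<And>x. u x \<le> M"
  shows "u x \<le> hopf_lax m \<tau> u x" "hopf_lax m \<tau> u x \<le> M"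
proof -
  obtain y where y: "hopf_lax m \<tau> u x = u y - m * (x - y)^2 / (4 * \<tau>)"
    "\<And>z. u z - m * (x - z)^2 / (4 * \<tau>) \<le> hopf_lax m \<tau> u x"
    using hopf_lax_attained[OF assms, of x] by blast
  show "u x \<le> hopf_lax m \<tau> u x" using y(2)[of x] by simp
  have "m * (x - y)^2 / (4 * \<tau>) \<ge> 0" using assms by simp
  thus "hopf_lax m \<tau> u x \<le> M" using y(1) assms(4)[of y] by simp
qed

text \<open>At this distance from the support the penalty exceeds \<open>M\<close>, so no point of
  the support contributes a positive value. This supplies end points at which
  \<open>hopf_lax_variation\<close> can require \<open>u\<close> and its sup-convolution to
  agree.\<close>

lemma hopf_lax_eq_0_outside:
  assumes "m > 0" "\<tau> > 0" "continuous_on UNIV u" "\<And>x. u x \<le> M"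
    and supp: "\<And>x. x \<notin> {a<..<b} \<Longrightarrow> u x = 0"
    and x: "\<And>z. z \<in> {a<..<b} \<Longrightarrow> \<bar>x - z\<bar> \<ge> 1 + 4 * \<tau> / m * M" "x \<notin> {a<..<b}"
  shows "hopf_lax m \<tau> u x = 0"
proof -
  obtain y where y: "hopf_lax m \<tau> u x = u y - m * (x - y)^2 / (4 * \<tau>)"
    using hopf_lax_attained[OF assms(1-4), of x] by blast
  define R where "R = 1 + 4 * \<tau> / m * M"
  have M: "M \<ge> 0" using assms(4)[of x] supp[of x] x(2) by simp
  hence R: "R \<ge> 1" using assms by (simp add: R_def)
  have "u y - m * (x - y)^2 / (4 * \<tau>) \<le> 0"
  proof (cases "y \<in> {a<..<b}")
    case True
    hence "\<bar>x - y\<bar> \<ge> R" using x by (simp add: R_def)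
    moreover have "R \<le> R^2" using R by (simp add: power2_eq_square)
    ultimately have "(x - y)^2 \<ge> R"
      using R power_mono[of R "\<bar>x - y\<bar>" 2] by simp
    hence "m * (x - y)^2 / (4 * \<tau>) \<ge> m * R / (4 * \<tau>)"
      using assms by (intro divide_right_mono mult_left_mono) auto
    also have "m * R / (4 * \<tau>) = m / (4 * \<tau>) + M"
      using assms by (simp add: R_def field_simps)
    finally show ?thesis using assms(4)[of y] assms by (smt (verit) divide_pos_pos)
  qed (use supp[of y] assms in simp)
  moreover have "u x \<le> hopf_lax m \<tau> u x"
    using hopf_lax_bounds(1)[OF assms(1-4), of x] .
  ultimately show ?thesis using y supp[OF x(2)] by simp
qed

text \<open>A maximiser belonging to a discrete local maximum of the sup-convolution cannot lie beyond
  the neighbouring sample points, where the sup-convolution would otherwise be larger. Hence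
  maximisers at the local maxima and the sample points themselves elsewhere are in order.\<close>

lemma hopf_lax_variation:
  fixes p :: "nat \<Rightarrow> real"
  assumes "m > 0" "\<tau> > 0" "continuous_on UNIV u" "\<And>x. u x \<le> M"
    and p: "strict_mono_on {..n} p"
    and ends: "hopf_lax m \<tau> u (p 0) = u (p 0)" "hopf_lax m \<tau> u (p n) = u (p n)"
    and V: "\<And>z :: nat \<Rightarrow> real. (\<And>i. i < n \<Longrightarrow> z i \<le> z (Suc i)) \<Longrightarrow> (\<Sum>i<n. \<bar>u (z (Suc i)) - u (z i)\<bar>) \<le> V"
  shows "(\<Sum>i<n. \<bar>hopf_lax m \<tau> u (p (Suc i)) - hopf_lax m \<tau> u (p i)\<bar>) \<le> V"
proof -
  define F where "F = hopf_lax m \<tau> u"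
  define c where "c = m / (4 * \<tau>)"
  have c: "c > 0" using assms by (simp add: c_def)
  have "\<exists>y. F x = u y - c * (x - y)^2 \<and> (\<forall>x' z. u z - c * (x' - z)^2 \<le> F x')" for x
  proof -
    obtain y where "F x = u y - c * (x - y)^2"
      using hopf_lax_attained[OF assms(1-4), of x] unfolding F_def c_def by (metis times_divide_eq_left)
    moreover have "u z - c * (x' - z)^2 \<le> F x'" for x' z
      using hopf_lax_attained[OF assms(1-4), of x'] unfolding F_def c_def by (metis times_divide_eq_left)
    ultimately show ?thesis by blast
  qed
  then obtain Y where Y: "\<And>x. F x = u (Y x) - c * (x - Y x)^2"
    and upper: "\<And>x z. u z - c * (x - z)^2 \<le> F x" by metis
  have lt: "p i < p (Suc i)" if "i < n" for i
    using that p by (auto simp: strict_mono_on_def)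
  \<comment> \<open>Ties are broken as in \<open>variation_comparison\<close>. The two ends are
    never \<open>top\<close>, so \<open>z\<close> agrees with \<open>p\<close> there.\<close>
  define top where "top i \<longleftrightarrow> 0 < i \<and> i < n \<and> F (p (i - 1)) \<le> F (p i) \<and> F (p (Suc i)) < F (p i)" for i
  define z where "z i = (if top i then Y (p i) else p i)" for i
  \<comment> \<open>A maximiser beyond \<open>p (Suc i)\<close> is closer to
    \<open>p (Suc i)\<close> than to \<open>p i\<close>, so used at \<open>p (Suc i)\<close> it
    gives at least \<open>F (p i)\<close>.\<close>
  have right: "Y (p i) \<le> p (Suc i)" if "top i" for i
  proof (rule ccontr)
    assume *: "\<not> Y (p i) \<le> p (Suc i)"
    have "p i < p (Suc i)" using that lt by (simp add: top_def)
    hence "(p (Suc i) - Y (p i))^2 \<le> (p i - Y (p i))^2"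
      using * by (simp add: abs_le_square_iff[symmetric])
    hence "c * (p (Suc i) - Y (p i))^2 \<le> c * (p i - Y (p i))^2" using c by simp
    hence "F (p i) \<le> F (p (Suc i))" using Y[of "p i"] upper[of "Y (p i)" "p (Suc i)"] by linarith
    thus False using that by (simp add: top_def)
  qed
  \<comment> \<open>On this side \<open>top\<close> allows equal values, so the comparison of
    distances has to be strict.\<close>
  have left: "p i \<le> Y (p (Suc i))" if "top (Suc i)" for i
  proof (rule ccontr)
    assume *: "\<not> p i \<le> Y (p (Suc i))"
    have "p i < p (Suc i)" using that lt by (simp add: top_def)
    hence "(p i - Y (p (Suc i)))^2 < (p (Suc i) - Y (p (Suc i)))^2"
      using * by (intro power_strict_mono) auto
    hence "c * (p i - Y (p (Suc i)))^2 < c * (p (Suc i) - Y (p (Suc i)))^2" using c by simp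
    hence "F (p (Suc i)) < F (p i)"
      using Y[of "p (Suc i)"] upper[of "Y (p (Suc i))" "p i"] by linarith
    thus False using that by (simp add: top_def)
  qed
  have "z i \<le> z (Suc i)" if "i < n" for i
  proof -
    \<comment> \<open>With these ties two adjacent points cannot both be \<open>top\<close>, so at
      most one of \<open>z i\<close> and \<open>z (Suc i)\<close> is a maximiser.\<close>
    have "\<not> (top i \<and> top (Suc i))" by (auto simp: top_def)
    thus ?thesis using right[of i] left[of i] lt[OF that] by (auto simp: z_def)
  qed
  moreover have "(\<Sum>i<n. \<bar>F (p (Suc i)) - F (p i)\<bar>) \<le> (\<Sum>i<n. \<bar>u (z (Suc i)) - u (z i)\<bar>)"
  proof (rule variation_comparison)
    show "F (p 0) = u (z 0)" "F (p n) = u (z n)"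
      using ends by (auto simp: F_def z_def top_def)
  next
    fix i assume "Suc i < n" "F (p i) \<le> F (p (Suc i))" "F (p (Suc (Suc i))) < F (p (Suc i))"
    hence "z (Suc i) = Y (p (Suc i))" by (simp add: z_def top_def)
    thus "F (p (Suc i)) \<le> u (z (Suc i))" using Y[of "p (Suc i)"] c by simp
  next
    fix i assume "Suc i < n" "F (p (Suc i)) < F (p i)"
    hence "z (Suc i) = p (Suc i)" by (simp add: z_def top_def)
    thus "u (z (Suc i)) \<le> F (p (Suc i))" using upper[of "p (Suc i)" "p (Suc i)"] by simp
  qed
  ultimately show ?thesis using V[of z] unfolding F_def by (meson order_trans)
qed

section \<open>Continuous piecewise affine functions on a grid\<close>

lemma affine_fun_on_cmult: "affine_fun_on S f \<Longrightarrow> affine_fun_on S (\<lambda>x. c * f x)"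
  unfolding affine_fun_on_def
proof (elim exE)
  fix \<alpha> \<beta> assume "\<forall>x\<in>S. f x = \<alpha> * x + \<beta>"
  thus "\<exists>\<alpha> \<beta>. \<forall>x\<in>S. c * f x = \<alpha> * x + \<beta>"
    by (intro exI[of _ "c * \<alpha>"] exI[of _ "c * \<beta>"]) (auto simp: algebra_simps)
qed

lemma affine_fun_on_add: "affine_fun_on S f \<Longrightarrow> affine_fun_on S g \<Longrightarrow> affine_fun_on S (\<lambda>x. f x + g x)"
  unfolding affine_fun_on_def
proof (elim exE)
  fix \<alpha> \<beta> \<gamma> \<delta> assume "\<forall>x\<in>S. f x = \<alpha> * x + \<beta>" "\<forall>x\<in>S. g x = \<gamma> * x + \<delta>"
  thus "\<exists>\<alpha> \<beta>. \<forall>x\<in>S. f x + g x = \<alpha> * x + \<beta>"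
    by (intro exI[of _ "\<alpha> + \<gamma>"] exI[of _ "\<beta> + \<delta>"]) (auto simp: algebra_simps)
qed

lemma affine_fun_on_const: "affine_fun_on S (\<lambda>x. c)"
  unfolding affine_fun_on_def by (intro exI[of _ 0] exI[of _ c]) auto

lemma affine_fun_on_sum:
  "finite A \<Longrightarrow> (\<And>i. i \<in> A \<Longrightarrow> affine_fun_on S (f i)) \<Longrightarrow> affine_fun_on S (\<lambda>x. \<Sum>i\<in>A. f i x)"
  by (induction A rule: finite_induct) (auto intro: affine_fun_on_add affine_fun_on_const)

definition ramp :: "real \<Rightarrow> real \<Rightarrow> real \<Rightarrow> real" where
  "ramp a b x = max 0 (min 1 ((x - a) / (b - a)))"

lemma ramp_le: "a < b \<Longrightarrow> x \<le> a \<Longrightarrow> ramp a b x = 0"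
  by (auto simp: ramp_def divide_nonpos_pos)

lemma ramp_ge: "a < b \<Longrightarrow> b \<le> x \<Longrightarrow> ramp a b x = 1"
  by (auto simp: ramp_def le_divide_eq)

lemma ramp_mid: "a < b \<Longrightarrow> x \<in> {a..b} \<Longrightarrow> ramp a b x = (x - a) / (b - a)"
  by (auto simp: ramp_def)

lemma ramp_mono: "a < b \<Longrightarrow> x \<le> y \<Longrightarrow> ramp a b x \<le> ramp a b y"
  unfolding ramp_def by (intro max.mono min.mono divide_right_mono) auto

lemma ramp_bounds: "0 \<le> ramp a b x" "ramp a b x \<le> 1"
  by (auto simp: ramp_def)

lemma continuous_on_ramp: "continuous_on S (ramp a b)"
  unfolding ramp_def divide_inverse by (intro continuous_intros)

text \<open>A counterpart of \<open>Vh\<close> in which end cells and inner cells are on the same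
  footing; \<open>Vh_eq\<close> identifies the two.\<close>

definition piecewise_affine :: "(nat \<Rightarrow> real) \<Rightarrow> nat \<Rightarrow> (real \<Rightarrow> real) set" where
  "piecewise_affine p n = {\<phi>. continuous_on UNIV \<phi> \<and> (\<forall>x. x \<notin> {p 0<..<p n} \<longrightarrow> \<phi> x = 0) \<and>
     (\<forall>j<n. affine_fun_on {p j<..<p (Suc j)} \<phi>)}"

definition piece_slope :: "(nat \<Rightarrow> real) \<Rightarrow> (real \<Rightarrow> real) \<Rightarrow> nat \<Rightarrow> real" where
  "piece_slope p \<phi> j = (\<phi> (p (Suc j)) - \<phi> (p j)) / (p (Suc j) - p j)"

definition nodal_variation :: "(nat \<Rightarrow> real) \<Rightarrow> nat \<Rightarrow> (real \<Rightarrow> real) \<Rightarrow> real" where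
  "nodal_variation p n \<phi> = (\<Sum>j<n. \<bar>\<phi> (p (Suc j)) - \<phi> (p j)\<bar>)"

text \<open>Ramps instead of hat functions: the coefficients are the nodal increments and each ramp
  is monotone, which is what the variation estimate uses. The value \<open>c 0\<close> is not added,
  so the nodal values are reproduced only if \<open>c 0 = 0\<close>.\<close>

definition affine_interp :: "(nat \<Rightarrow> real) \<Rightarrow> nat \<Rightarrow> (nat \<Rightarrow> real) \<Rightarrow> real \<Rightarrow> real" where
  "affine_interp p n c x = (\<Sum>j<n. (c (Suc j) - c j) * ramp (p j) (p (Suc j)) x)"

text \<open>Intended for integrands containing \<open>deriv\<close>, whose values at the nodes are
  unspecified. Measurability of \<open>f\<close> comes from writing it as \<open>g\<close> plus
  finitely many point corrections.\<close>

lemma lborel_integral_eq_off_finite: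
  fixes f g :: "real \<Rightarrow> real"
  assumes g: "has_bochner_integral lborel g I" and A: "finite A" and eq: "\<And>x. x \<notin> A \<Longrightarrow> f x = g x"
  shows "integral\<^sup>L lborel f = I"
proof -
  have [measurable]: "g \<in> borel_measurable borel" using g by (auto simp: has_bochner_integral_iff)
  have "f = (\<lambda>x. g x + (\<Sum>a\<in>A. (f a - g a) * indicator {a} x))"
  proof
    fix x
    have "(\<Sum>a\<in>A. (f a - g a) * indicator {a} x) = (\<Sum>a\<in>A. if a = x then f x - g x else 0)"
      by (intro sum.cong) (auto simp: indicator_def)
    thus "f x = g x + (\<Sum>a\<in>A. (f a - g a) * indicator {a} x)" using A eq[of x] by auto
  qed
  moreover have "(\<lambda>x. g x + (\<Sum>a\<in>A. (f a - g a) * indicator {a} x)) \<in> borel_measurable borel"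
    by measurable
  ultimately have [measurable]: "f \<in> borel_measurable borel" by simp
  have "AE x in lborel. x \<notin> A" using A finite_imp_null_set_lborel AE_not_in by blast
  hence "AE x in lborel. f x = g x" by eventually_elim (simp add: eq)
  hence "integral\<^sup>L lborel f = integral\<^sup>L lborel g" by (intro integral_cong_AE) auto
  thus ?thesis using has_bochner_integral_integral_eq[OF g] by simp
qed

locale grid =
  fixes p :: "nat \<Rightarrow> real" and n :: nat
  assumes strict: "strict_mono_on {..n} p"
begin

lemma less: "i < j \<Longrightarrow> j \<le> n \<Longrightarrow> p i < p j"
  using strict by (auto simp: strict_mono_on_def)

lemma le: "i \<le> j \<Longrightarrow> j \<le> n \<Longrightarrow> p i \<le> p j"
  using less[of i j] by (cases "i = j") auto

lemma cell_exists:
  assumes "x \<in> {p 0<..<p n}"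
  obtains j where "j < n" "x \<in> {p j..p (Suc j)}"
proof -
  define j where "j = (LEAST i. x \<le> p i)"
  have "x \<le> p n" using assms by simp
  hence j: "x \<le> p j" "j \<le> n" unfolding j_def by (auto intro: LeastI Least_le)
  then obtain i where i: "j = Suc i" using assms by (cases j) auto
  have "\<not> x \<le> p i" using not_less_Least[of i "\<lambda>i. x \<le> p i"] i by (simp add: j_def)
  thus ?thesis using that[of i] i j by auto
qed

text \<open>The space prescribes affinity on open cells only; continuity carries it to the closed
  cell, and the two end values identify the coefficient.\<close>

lemma piecewise_affineD:
  assumes "\<phi> \<in> piecewise_affine p n" "j < n" "x \<in> {p j..p (Suc j)}"
  shows "\<phi> x = \<phi> (p j) + piece_slope p \<phi> j * (x - p j)"
proof -
  obtain \<alpha> \<beta> where ab: "\<And>x. x \<in> {p j<..<p (Suc j)} \<Longrightarrow> \<phi> x = \<alpha> * x + \<beta>"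
    using assms by (force simp: piecewise_affine_def affine_fun_on_def)
  have lt: "p j < p (Suc j)" using assms less by simp
  have *: "\<phi> x = \<alpha> * x + \<beta>" if "x \<in> {p j..p (Suc j)}" for x
  proof (rule continuous_constant_on_closure[of "{p j<..<p (Suc j)}" "\<lambda>x. \<phi> x - (\<alpha> * x + \<beta>)" 0, THEN eq_iff_diff_eq_0[THEN iffD2]])
    show "continuous_on (closure {p j<..<p (Suc j)}) (\<lambda>x. \<phi> x - (\<alpha> * x + \<beta>))"
      using assms(1) unfolding piecewise_affine_def
      by (intro continuous_intros) (auto intro: continuous_on_subset)
  qed (use ab lt that in auto)
  have "\<phi> (p (Suc j)) - \<phi> (p j) = \<alpha> * (p (Suc j) - p j)"
    using *[of "p j"] *[of "p (Suc j)"] lt by (simp add: algebra_simps)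
  hence "piece_slope p \<phi> j = \<alpha>" using lt by (simp add: piece_slope_def)
  thus ?thesis using *[OF assms(3)] *[of "p j"] lt by (simp add: algebra_simps)
qed

text \<open>Inside a cell the value is a convex combination of two nodal values; outside the grid it
  is 0, which is the nodal value at \<open>p 0\<close>.\<close>

lemma piecewise_affine_convex:
  assumes "\<phi> \<in> piecewise_affine p n" and "\<And>j. j \<le> n \<Longrightarrow> a \<le> \<phi> (p j) \<and> \<phi> (p j) \<le> b"
  shows "a \<le> \<phi> x \<and> \<phi> x \<le> b"
proof (cases "x \<in> {p 0<..<p n}")
  case True
  then obtain j where j: "j < n" "x \<in> {p j..p (Suc j)}" by (rule cell_exists)
  define s where "s = (x - p j) / (p (Suc j) - p j)"
  have lt: "p j < p (Suc j)" using j less by simp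
  have s: "0 \<le> s" "s \<le> 1" using j lt by (auto simp: s_def)
  have "\<phi> x = \<phi> (p j) + s * (\<phi> (p (Suc j)) - \<phi> (p j))"
    using piecewise_affineD[OF assms(1) j] by (simp add: piece_slope_def s_def)
  hence "\<phi> x = (1 - s) * \<phi> (p j) + s * \<phi> (p (Suc j))" by (simp add: algebra_simps)
  moreover have "(1 - s) * a + s * a \<le> (1 - s) * \<phi> (p j) + s * \<phi> (p (Suc j))"
    "(1 - s) * \<phi> (p j) + s * \<phi> (p (Suc j)) \<le> (1 - s) * b + s * b"
    using s j assms(2)[of j] assms(2)[of "Suc j"] by (intro add_mono mult_left_mono; simp)+
  moreover have "(1 - s) * a + s * a = a" "(1 - s) * b + s * b = b" by (simp_all add: algebra_simps)
  ultimately show ?thesis by simp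
next
  case False
  hence "\<phi> x = 0" "\<phi> (p 0) = 0" using assms(1) by (auto simp: piecewise_affine_def)
  thus ?thesis using assms(2)[of 0] by simp
qed

lemma piecewise_affine_eqI:
  assumes "\<phi> \<in> piecewise_affine p n" "\<psi> \<in> piecewise_affine p n" "\<And>j. 0 < j \<Longrightarrow> j < n \<Longrightarrow> \<phi> (p j) = \<psi> (p j)"
  shows "\<phi> = \<psi>"
proof
  fix x
  have eq: "\<phi> (p j) = \<psi> (p j)" if "j \<le> n" for j
    using assms that by (cases "j = 0"; cases "j = n") (auto simp: piecewise_affine_def)
  show "\<phi> x = \<psi> x"
  proof (cases "x \<in> {p 0<..<p n}")
    case True
    then obtain j where j: "j < n" "x \<in> {p j..p (Suc j)}" by (rule cell_exists)
    thus ?thesis using piecewise_affineD[OF assms(1) j] piecewise_affineD[OF assms(2) j] eq[of j] eq[of "Suc j"]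
      by (simp add: piece_slope_def)
  qed (use assms in \<open>auto simp: piecewise_affine_def\<close>)
qed

lemma affine_interp_node:
  assumes "c 0 = 0" "j \<le> n"
  shows "affine_interp p n c (p j) = c j"
proof -
  have "affine_interp p n c (p j) = (\<Sum>i<n. if i < j then c (Suc i) - c i else 0)"
    unfolding affine_interp_def
  proof (intro sum.cong refl)
    fix i assume "i \<in> {..<n}"
    thus "(c (Suc i) - c i) * ramp (p i) (p (Suc i)) (p j) = (if i < j then c (Suc i) - c i else 0)"
      using less[of i "Suc i"] le[of "Suc i" j] le[of j i] assms
      by (auto simp: ramp_ge ramp_le)
  qed
  also have "\<dots> = (\<Sum>i<j. c (Suc i) - c i)"
    using assms by (intro sum.mono_neutral_cong_right) auto
  also have "\<dots> = c j" using assms by (simp add: sum_lessThan_telescope)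
  finally show ?thesis .
qed

lemma affine_interp_in:
  assumes "c 0 = 0" "c n = 0"
  shows "affine_interp p n c \<in> piecewise_affine p n"
  unfolding piecewise_affine_def
proof (intro CollectI conjI allI impI)
  show "continuous_on UNIV (affine_interp p n c)"
    unfolding affine_interp_def by (intro continuous_intros continuous_on_ramp)
next
  fix x assume x: "x \<notin> {p 0<..<p n}"
  consider "x \<le> p 0" | "x \<ge> p n" using x by fastforce
  thus "affine_interp p n c x = 0"
  proof cases
    case 1
    have "ramp (p i) (p (Suc i)) x = 0" if "i < n" for i
      using that 1 less[of i "Suc i"] le[of 0 i] by (intro ramp_le) auto
    thus ?thesis by (simp add: affine_interp_def)
  next
    case 2
    have "ramp (p i) (p (Suc i)) x = 1" if "i < n" for i
      using that 2 less[of i "Suc i"] le[of "Suc i" n] by (intro ramp_ge) auto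
    hence "affine_interp p n c x = (\<Sum>i<n. c (Suc i) - c i)" by (simp add: affine_interp_def)
    thus ?thesis using assms by (simp add: sum_lessThan_telescope)
  qed
next
  fix j assume j: "j < n"
  have "affine_fun_on {p j<..<p (Suc j)} (ramp (p i) (p (Suc i)))" if i: "i < n" for i
  proof -
    have lt: "p i < p (Suc i)" using i less by simp
    consider "i < j" | "i = j" | "j < i" by linarith
    thus ?thesis
    proof cases
      case 1
      hence "ramp (p i) (p (Suc i)) x = 1" if "x \<in> {p j<..<p (Suc j)}" for x
        using lt that le[of "Suc i" j] j by (intro ramp_ge) auto
      thus ?thesis unfolding affine_fun_on_def by (intro exI[of _ 0] exI[of _ 1]) auto
    next
      case 2
      thus ?thesis using lt unfolding affine_fun_on_def
        by (intro exI[of _ "1 / (p (Suc i) - p i)"] exI[of _ "- p i / (p (Suc i) - p i)"])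
          (auto simp: ramp_mid diff_divide_distrib)
    next
      case 3
      hence "ramp (p i) (p (Suc i)) x = 0" if "x \<in> {p j<..<p (Suc j)}" for x
        using lt that le[of "Suc j" i] i by (intro ramp_le) auto
      thus ?thesis unfolding affine_fun_on_def by (intro exI[of _ 0] exI[of _ 0]) auto
    qed
  qed
  thus "affine_fun_on {p j<..<p (Suc j)} (affine_interp p n c)"
    unfolding affine_interp_def[abs_def] by (intro affine_fun_on_sum affine_fun_on_cmult) auto
qed

lemma piecewise_affine_repr:
  assumes "\<phi> \<in> piecewise_affine p n"
  shows "\<phi> = affine_interp p n (\<lambda>j. \<phi> (p j))"
  using assms
  by (intro piecewise_affine_eqI affine_interp_in)
     (auto simp: affine_interp_node piecewise_affine_def)

text \<open>In the ramp representation every increment of \<open>\<phi>\<close> is a combination of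
  ramp increments. Along a nondecreasing sequence the increments of one ramp are nonnegative and
  telescope to at most 1.\<close>

lemma variation_le_nodal_variation:
  assumes "\<phi> \<in> piecewise_affine p n" and z: "\<And>i. i < k \<Longrightarrow> z i \<le> z (Suc i)"
  shows "(\<Sum>i<k. \<bar>\<phi> (z (Suc i)) - \<phi> (z i)\<bar>) \<le> nodal_variation p n \<phi>"
proof -
  let ?d = "\<lambda>j. \<phi> (p (Suc j)) - \<phi> (p j)" and ?r = "\<lambda>j. ramp (p j) (p (Suc j))"
  have "(\<Sum>i<k. \<bar>\<phi> (z (Suc i)) - \<phi> (z i)\<bar>) \<le> (\<Sum>i<k. \<Sum>j<n. \<bar>?d j\<bar> * (?r j (z (Suc i)) - ?r j (z i)))"
  proof (intro sum_mono)
    fix i assume "i \<in> {..<k}"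
    hence zi: "z i \<le> z (Suc i)" using z by simp
    have repr: "\<phi> x = (\<Sum>j<n. ?d j * ?r j x)" for x
      using fun_cong[OF piecewise_affine_repr[OF assms(1)], of x] by (simp add: affine_interp_def)
    have "\<phi> (z (Suc i)) - \<phi> (z i) = (\<Sum>j<n. ?d j * (?r j (z (Suc i)) - ?r j (z i)))"
      by (simp add: repr[of "z (Suc i)"] repr[of "z i"] right_diff_distrib sum_subtractf)
    hence "\<bar>\<phi> (z (Suc i)) - \<phi> (z i)\<bar> \<le> (\<Sum>j<n. \<bar>?d j * (?r j (z (Suc i)) - ?r j (z i))\<bar>)"
      by (simp only: sum_abs)
    also have "\<dots> = (\<Sum>j<n. \<bar>?d j\<bar> * (?r j (z (Suc i)) - ?r j (z i)))"
      using ramp_mono[OF less zi] by (intro sum.cong) (auto simp: abs_mult)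
    finally show "\<bar>\<phi> (z (Suc i)) - \<phi> (z i)\<bar> \<le> (\<Sum>j<n. \<bar>?d j\<bar> * (?r j (z (Suc i)) - ?r j (z i)))" .
  qed
  also have "\<dots> = (\<Sum>j<n. \<bar>?d j\<bar> * (\<Sum>i<k. ?r j (z (Suc i)) - ?r j (z i)))"
    by (subst sum.swap) (simp add: sum_distrib_left)
  also have "\<dots> = (\<Sum>j<n. \<bar>?d j\<bar> * (?r j (z k) - ?r j (z 0)))"
    using sum_lessThan_telescope[of "\<lambda>i. ?r _ (z i)" k] by simp
  also have "\<dots> \<le> (\<Sum>j<n. \<bar>?d j\<bar> * 1)"
  proof (intro sum_mono mult_left_mono)
    fix j show "?r j (z k) - ?r j (z 0) \<le> 1"
      using ramp_bounds[of "p j" "p (Suc j)" "z k"] ramp_bounds[of "p j" "p (Suc j)" "z 0"] by linarith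
  qed auto
  finally show ?thesis by (simp add: nodal_variation_def)
qed

section \<open>Derivatives and the diffusion term\<close>

lemma piecewise_affine_has_derivative:
  assumes "\<phi> \<in> piecewise_affine p n" "j < n" "x \<in> {p j<..<p (Suc j)}"
  shows "(\<phi> has_field_derivative piece_slope p \<phi> j) (at x)"
proof (rule has_field_derivative_transform_within_open[where S = "{p j<..<p (Suc j)}"])
  show "((\<lambda>x. \<phi> (p j) + piece_slope p \<phi> j * (x - p j)) has_field_derivative piece_slope p \<phi> j) (at x)"
    by (auto intro!: derivative_eq_intros)
  fix y assume "y \<in> {p j<..<p (Suc j)}"
  thus "\<phi> (p j) + piece_slope p \<phi> j * (y - p j) = \<phi> y"
    using piecewise_affineD[OF assms(1,2), of y] by auto
qed (use assms(3) in auto)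

lemma piecewise_affine_deriv_outside:
  assumes "\<phi> \<in> piecewise_affine p n" "x < p 0 \<or> p n < x"
  shows "deriv \<phi> x = 0"
proof (rule DERIV_imp_deriv)
  show "(\<phi> has_field_derivative 0) (at x)"
  proof (rule has_field_derivative_transform_within_open[where S = "- {p 0..p n}"])
    show "((\<lambda>x. 0) has_field_derivative 0) (at x)" by simp
  qed (use assms in \<open>auto simp: piecewise_affine_def\<close>)
qed

text \<open>On each cell the derivative of \<open>u\<close> is constant, so only the derivative of
  the product is left to integrate and the fundamental theorem gives an exact value, although the
  product is quadratic.\<close>

lemma L2_inner_deriv_product:
  assumes u: "u \<in> piecewise_affine p n" and w: "w \<in> piecewise_affine p n" and \<phi>: "\<phi> \<in> piecewise_affine p n"
  shows "L2_inner (deriv u) (deriv (\<lambda>x. w x * \<phi> x)) =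
    (\<Sum>j<n. piece_slope p u j * (w (p (Suc j)) * \<phi> (p (Suc j)) - w (p j) * \<phi> (p j)))"
proof -
  \<comment> \<open>The polynomial that the product equals on the closed cell \<open>j\<close>.
    Being defined on the whole line, it is differentiable at the nodes too, where the product itself
    may have a kink.\<close>
  define P where "P j x = (w (p j) + piece_slope p w j * (x - p j)) * (\<phi> (p j) + piece_slope p \<phi> j * (x - p j))" for j x
  define D where "D j x = piece_slope p w j * (\<phi> (p j) + piece_slope p \<phi> j * (x - p j)) +
    (w (p j) + piece_slope p w j * (x - p j)) * piece_slope p \<phi> j" for j x
  have P': "(P j has_field_derivative D j x) (at x)" for j x
    unfolding P_def D_def by (auto intro!: derivative_eq_intros)
  have P_eq: "P j x = w x * \<phi> x" if "j < n" "x \<in> {p j..p (Suc j)}" for j x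
    using piecewise_affineD[OF w that] piecewise_affineD[OF \<phi> that] by (simp add: P_def)
  have lt: "p j < p (Suc j)" if "j < n" for j using that less by simp
  have int: "has_bochner_integral lborel (\<lambda>x. D j x * indicator {p j..p (Suc j)} x) (P j (p (Suc j)) - P j (p j))"
    if "j < n" for j
  proof (rule has_bochner_integral_FTC_Icc_real)
    fix x show "isCont (D j) x" unfolding D_def by (intro continuous_intros)
  qed (use lt[OF that] P' in \<open>auto simp: less_imp_le\<close>)
  have int_sum: "has_bochner_integral lborel (\<lambda>x. \<Sum>j<n. piece_slope p u j * (D j x * indicator {p j..p (Suc j)} x))
      (\<Sum>j<n. piece_slope p u j * (P j (p (Suc j)) - P j (p j)))"
    using int by (intro has_bochner_integral_sum has_bochner_integral_mult_right) auto
  have "L2_inner (deriv u) (deriv (\<lambda>x. w x * \<phi> x)) = (\<Sum>j<n. piece_slope p u j * (P j (p (Suc j)) - P j (p j)))"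
    unfolding L2_inner_def
  proof (rule lborel_integral_eq_off_finite[OF int_sum])
    show "finite (p ` {..n})" by simp
    fix x assume x: "x \<notin> p ` {..n}"
    have "(\<Sum>j<n. piece_slope p u j * (D j x * indicator {p j..p (Suc j)} x)) =
      deriv u x * deriv (\<lambda>x. w x * \<phi> x) x"
    proof (cases "x \<in> {p 0<..<p n}")
      case True
      then obtain j where j: "j < n" "x \<in> {p j..p (Suc j)}" by (rule cell_exists)
      moreover have "x \<noteq> p j" "x \<noteq> p (Suc j)" using x j by auto
      ultimately have xj: "x \<in> {p j<..<p (Suc j)}" by auto
      have "x \<notin> {p i..p (Suc i)}" if "i < n" "i \<noteq> j" for i
        using that xj le[of "Suc i" j] le[of "Suc j" i] j by (cases "i < j") auto
      hence "(\<Sum>i<n. piece_slope p u i * (D i x * indicator {p i..p (Suc i)} x)) =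
          (\<Sum>i<n. if i = j then piece_slope p u j * D j x else 0)"
        using j by (intro sum.cong) auto
      also have "\<dots> = piece_slope p u j * D j x" using j by simp
      also have "piece_slope p u j = deriv u x"
        using DERIV_imp_deriv[OF piecewise_affine_has_derivative[OF u j(1) xj]] by simp
      also have "((\<lambda>x. w x * \<phi> x) has_field_derivative D j x) (at x)"
        by (rule has_field_derivative_transform_within_open[OF P', where S = "{p j<..<p (Suc j)}"])
          (use xj P_eq[OF j(1)] in auto)
      hence "D j x = deriv (\<lambda>x. w x * \<phi> x) x" by (simp add: DERIV_imp_deriv)
      finally show ?thesis .
    next
      case False
      moreover have "x \<noteq> p 0" "x \<noteq> p n" using x by auto
      ultimately have *: "x < p 0 \<or> p n < x" by auto
      hence "x \<notin> {p i..p (Suc i)}" if "i < n" for i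
        using le[of 0 i] le[of "Suc i" n] that by auto
      thus ?thesis using piecewise_affine_deriv_outside[OF u *] by simp
    qed
    thus "deriv u x * deriv (\<lambda>x. w x * \<phi> x) x =
      (\<Sum>j<n. piece_slope p u j * (D j x * indicator {p j..p (Suc j)} x))" by simp
  qed
  moreover have "P j (p (Suc j)) - P j (p j) = w (p (Suc j)) * \<phi> (p (Suc j)) - w (p j) * \<phi> (p j)" if "j < n" for j
    using P_eq[OF that, of "p j"] P_eq[OF that, of "p (Suc j)"] lt[OF that] by simp
  ultimately show ?thesis
    by simp
qed

end

section \<open>The mesh of the scheme\<close>

text \<open>This counts cells, the \<open>+ 2\<close> standing for the two end cells. In
  \<open>mesh\<close>, the inner point \<open>j\<close> is the node with integer index
  \<open>first_node h sm + int j - 1\<close>, so the inner cell \<open>j\<close> ends at index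
  \<open>first_node h sm + int j\<close>.\<close>

definition mesh_size :: "real \<Rightarrow> real \<Rightarrow> real \<Rightarrow> nat" where
  "mesh_size h sm sp = nat (last_node h sp - first_node h sm) + 2"

definition mesh :: "real \<Rightarrow> real \<Rightarrow> real \<Rightarrow> nat \<Rightarrow> real" where
  "mesh h sm sp j = (if j = 0 then - sm else if j < mesh_size h sm sp
     then node h (first_node h sm + int j - 1) else sp)"

text \<open>The bounds \<open>h_le\<close> make both values of \<open>end_index\<close> at least 1,
  so the node range contains 0 and is nonempty.\<close>

locale mesh_level =
  fixes h sm sp :: real
  assumes h_pos: "h > 0" and h_le: "h \<le> sm" "h \<le> sp"
begin

abbreviation "p \<equiv> mesh h sm sp"
abbreviation "n \<equiv> mesh_size h sm sp"
abbreviation "a \<equiv> first_node h sm"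
abbreviation "b \<equiv> last_node h sp"

lemma end_index_ge_1: "h \<le> s \<Longrightarrow> 1 \<le> end_index h s"
  using h_pos by (simp add: end_index_def le_floor_iff)

lemma first_le_last: "a \<le> b"
  using end_index_ge_1[OF h_le(1)] end_index_ge_1[OF h_le(2)]
  by (simp add: first_node_def last_node_def)

lemma end_index_mult_le: "of_int (end_index h s) * h \<le> s"
  using h_pos of_int_floor_le[of "s / h"] by (simp add: end_index_def le_divide_eq)

lemma end_length_pos: "end_length h s > 0"
  using end_index_mult_le[of s] h_pos by (simp add: end_length_def algebra_simps)

lemma end_lengths: "end_length h sm = node h a - (- sm)" "end_length h sp = sp - node h b"
  by (simp_all add: end_length_def node_def first_node_def last_node_def algebra_simps)

lemma mesh_simps:
  "p 0 = - sm" "p n = sp" "p 1 = node h a" "p (n - 1) = node h b"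
  "0 < j \<Longrightarrow> j < n \<Longrightarrow> p j = node h (a + int j - 1)"
  using first_le_last by (auto simp: mesh_def mesh_size_def)

lemma mesh_step: "0 < j \<Longrightarrow> Suc j < n \<Longrightarrow> p (Suc j) - p j = h"
  by (simp add: mesh_simps node_def algebra_simps)

lemma n_ge_2: "2 \<le> n"
  by (simp add: mesh_size_def)

sublocale grid p n
proof
  have step: "p j < p (Suc j)" if "j < n" for j
  proof -
    consider "j = 0" | "0 < j" "Suc j < n" | "0 < j" "Suc j = n" using \<open>j < n\<close> by linarith
    thus ?thesis
    proof cases
      case 1
      thus ?thesis using mesh_simps(1,3) end_lengths(1) end_length_pos[of sm] by simp
    next
      case 2
      thus ?thesis using mesh_step[of j] h_pos by simp
    next
      case 3
      thus ?thesis using mesh_simps(2,4) end_lengths(2) end_length_pos[of sp] by (metis diff_Suc_1 diff_gt_0_iff_gt)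
    qed
  qed
  show "strict_mono_on {..n} p"
  proof (rule strict_mono_onI)
    fix i j assume "i \<in> {..n}" "j \<in> {..n}" "i < j"
    thus "p i < p j"
    proof (induction j)
      case (Suc j)
      thus ?case using step[of j] by (cases "i = j") force+
    qed simp
  qed
qed

lemma all_nodes_iff: "(\<forall>i\<in>{a..b}. P i) \<longleftrightarrow> (\<forall>j. 0 < j \<and> j < n \<longrightarrow> P (a + int j - 1))"
proof (intro iffI ballI allI impI)
  fix i assume *: "\<forall>j. 0 < j \<and> j < n \<longrightarrow> P (a + int j - 1)" "i \<in> {a..b}"
  show "P i" using *(1)[rule_format, of "nat (i - a) + 1"] *(2) by (auto simp: mesh_size_def)
qed (use first_le_last in \<open>auto simp: mesh_size_def\<close>)

lemma all_inner_cells_iff: "(\<forall>i\<in>{a+1..b}. P i) \<longleftrightarrow> (\<forall>j. 0 < j \<and> Suc j < n \<longrightarrow> P (a + int j))"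
proof (intro iffI ballI allI impI)
  fix i assume *: "\<forall>j. 0 < j \<and> Suc j < n \<longrightarrow> P (a + int j)" "i \<in> {a+1..b}"
  show "P i" using *(1)[rule_format, of "nat (i - a)"] *(2) by (auto simp: mesh_size_def)
qed (use first_le_last in \<open>auto simp: mesh_size_def\<close>)

lemma sum_inner_cells: "(\<Sum>i = a+1..b. f i) = (\<Sum>j = 1..<n - 1. f (a + int j))"
  by (rule sum.reindex_bij_witness[of _ "\<lambda>j. a + int j" "\<lambda>i. nat (i - a)"])
     (auto simp: mesh_size_def)

lemma sum_cells: "(\<Sum>j<n. f j) = f 0 + (\<Sum>j = 1..<n - 1. f j) + f (n - 1)" for f :: "nat \<Rightarrow> real"
proof -
  have "{..<n} = insert 0 (insert (n - 1) {1..<n - 1})" using n_ge_2 by auto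
  thus ?thesis using n_ge_2 by simp
qed

lemma Vh_eq: "Vh h sm sp = piecewise_affine p n"
proof -
  have "(\<forall>j<n. affine_fun_on {p j<..<p (Suc j)} \<phi>) \<longleftrightarrow>
    (\<forall>i\<in>{a+1..b}. affine_fun_on {node h (i - 1)<..<node h i} \<phi>) \<and>
     affine_fun_on {-sm<..<node h a} \<phi> \<and> affine_fun_on {node h b<..<sp} \<phi>" for \<phi>
  proof -
    have "(\<forall>j<n. affine_fun_on {p j<..<p (Suc j)} \<phi>) \<longleftrightarrow>
      affine_fun_on {p 0<..<p 1} \<phi> \<and> affine_fun_on {p (n - 1)<..<p n} \<phi> \<and>
      (\<forall>j. 0 < j \<and> Suc j < n \<longrightarrow> affine_fun_on {p j<..<p (Suc j)} \<phi>)" (is "?L \<longleftrightarrow> ?R")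
    proof
      assume ?L
      thus ?R using n_ge_2 by (auto dest: spec[of _ 0] spec[of _ "n - 1"])
    next
      assume R: ?R
      show ?L
      proof (intro allI impI)
        fix j assume "j < n"
        then consider "j = 0" | "0 < j" "Suc j < n" | "j = n - 1" by linarith
        thus "affine_fun_on {p j<..<p (Suc j)} \<phi>" using R n_ge_2 by cases auto
      qed
    qed
    moreover have "(\<forall>j. 0 < j \<and> Suc j < n \<longrightarrow> affine_fun_on {p j<..<p (Suc j)} \<phi>) \<longleftrightarrow>
       (\<forall>i\<in>{a+1..b}. affine_fun_on {node h (i - 1)<..<node h i} \<phi>)"
      unfolding all_inner_cells_iff by (auto simp: mesh_simps)
    ultimately show ?thesis using mesh_simps(1-4) by auto
  qed
  thus ?thesis unfolding Vh_def piecewise_affine_def by (simp add: mesh_simps(1,2))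
qed

text \<open>The \<open>THE\<close> in \<open>interp\<close> denotes for every \<open>f\<close>:
  \<open>affine_interp\<close> gives existence and \<open>piecewise_affine_eqI\<close> uniqueness.
  The end values are set to 0 whatever \<open>f\<close> is there.\<close>

lemma interp_props:
  shows interp_in: "interp h sm sp f \<in> piecewise_affine p n"
    and interp_node: "0 < j \<Longrightarrow> j < n \<Longrightarrow> interp h sm sp f (p j) = f (p j)"
proof -
  define c where "c j = (if 0 < j \<and> j < n then f (p j) else 0)" for j
  define \<phi> where "\<phi> = affine_interp p n c"
  have in_V: "\<phi> \<in> piecewise_affine p n" unfolding \<phi>_def by (rule affine_interp_in) (auto simp: c_def)
  have node: "\<phi> (p j) = f (p j)" if "0 < j" "j < n" for j
    using that affine_interp_node[of c j] by (simp add: \<phi>_def c_def)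
  have "interp h sm sp f = \<phi>"
    unfolding interp_def all_nodes_iff Vh_eq
  proof (rule the_equality)
    show "\<phi> \<in> piecewise_affine p n \<and>
      (\<forall>j. 0 < j \<and> j < n \<longrightarrow> \<phi> (node h (a + int j - 1)) = f (node h (a + int j - 1)))"
      using in_V node by (simp add: mesh_simps(5)[symmetric])
  next
    fix \<psi> assume "\<psi> \<in> piecewise_affine p n \<and>
      (\<forall>j. 0 < j \<and> j < n \<longrightarrow> \<psi> (node h (a + int j - 1)) = f (node h (a + int j - 1)))"
    thus "\<psi> = \<phi>" using in_V node
      by (intro piecewise_affine_eqI) (auto simp: mesh_simps(5)[symmetric])
  qed
  thus "interp h sm sp f \<in> piecewise_affine p n" "0 < j \<Longrightarrow> j < n \<Longrightarrow> interp h sm sp f (p j) = f (p j)"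
    using in_V node by auto
qed

section \<open>Nodal form of the parabolic step\<close>

lemma hat_exists:
  assumes "0 < k" "k < n"
  obtains \<phi> where "\<phi> \<in> piecewise_affine p n" "\<And>j. j \<le> n \<Longrightarrow> \<phi> (p j) = (if j = k then 1 else 0)"
proof
  let ?c = "\<lambda>j. if j = k then 1 else 0 :: real"
  show "affine_interp p n ?c \<in> piecewise_affine p n" using assms by (intro affine_interp_in) auto
  show "affine_interp p n ?c (p j) = ?c j" if "j \<le> n" for j
    using assms affine_interp_node[of ?c j] that by simp
qed

text \<open>Later arguments use only that the weight is positive and does not depend on
  \<open>f\<close>, so its three possible forms are hidden behind \<open>\<mu>\<close>.\<close>

lemma lumped_hat:
  assumes "0 < k" "k < n" "\<And>j. j \<le> n \<Longrightarrow> \<phi> (p j) = (if j = k then 1 else 0)"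
  obtains \<mu> where "\<mu> > 0" "\<And>f. lumped h sm sp f \<phi> = \<mu> * f (p k)"
proof -
  define i0 where "i0 = a + int k - 1"
  have i0: "i0 \<in> {a..b}" "p k = node h i0"
    using assms first_le_last by (auto simp: i0_def mesh_simps mesh_size_def)
  have \<phi>: "\<phi> (node h i) = (if i = i0 then 1 else 0)" if "i \<in> {a..b}" for i
  proof -
    have "\<forall>i\<in>{a..b}. \<phi> (node h i) = (if i = i0 then 1 else 0)"
      unfolding all_nodes_iff i0_def using assms(3) by (auto simp: mesh_simps(5)[symmetric])
    thus ?thesis using that by blast
  qed
  \<comment> \<open>A sum of three cases rather than a case distinction: if there is a single node,
    then \<open>a = b\<close> and both end weights apply to it.\<close>
  define \<mu> where "\<mu> = (if i0 = a then (end_length h sm + h) / 2 else 0) +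
     (if i0 \<in> {a+1..b-1} then h else 0) + (if i0 = b then (end_length h sp + h) / 2 else 0)"
  have "lumped h sm sp f \<phi> = \<mu> * f (p k)" for f
  proof -
    have "(\<Sum>i = a+1..b-1. f (node h i) * \<phi> (node h i)) = (\<Sum>i = a+1..b-1. if i = i0 then f (node h i0) else 0)"
      using \<phi> by (intro sum.cong) auto
    hence "(\<Sum>i = a+1..b-1. f (node h i) * \<phi> (node h i)) = (if i0 \<in> {a+1..b-1} then f (node h i0) else 0)"
      by simp
    moreover have "\<phi> (node h a) = (if i0 = a then 1 else 0)" "\<phi> (node h b) = (if i0 = b then 1 else 0)"
      using \<phi>[of a] \<phi>[of b] first_le_last by auto
    ultimately show ?thesis
      unfolding lumped_def Let_def \<mu>_def i0(2) by (auto simp: algebra_simps)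
  qed
  moreover have "\<mu> > 0"
    using i0(1) h_pos end_length_pos[of sm] end_length_pos[of sp] by (auto simp: \<mu>_def intro!: add_pos_pos)
  ultimately show ?thesis using that by blast
qed

text \<open>Test with the hat function of the node. Mass lumping makes the reaction terms local,
  \<open>interp\<close> drops out at a node, and the diffusion term keeps only the two adjacent
  cells, because the product of \<open>w\<close> and the hat function vanishes at all other
  nodes.\<close>

lemma parabolic_step_node:
  assumes step: "parabolic_step m q \<tau> h sm sp w u" and w: "w \<in> piecewise_affine p n"
    and k: "Suc k < n"
  obtains \<mu> where "\<mu> > 0"
    "\<mu> * u (p (Suc k)) + \<tau> * w (p (Suc k)) * (piece_slope p u k - piece_slope p u (Suc k)) =
     \<mu> * (w (p (Suc k)) + m * q * \<tau> * (w (p (Suc k)) powr q * u (p (Suc k))) + m * (1 - q) * \<tau> * w (p (Suc k)) powr (q + 1))"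
proof -
  have k': "0 < Suc k" by simp
  obtain \<phi> where \<phi>: "\<phi> \<in> piecewise_affine p n" "\<And>j. j \<le> n \<Longrightarrow> \<phi> (p j) = (if j = Suc k then 1 else 0)"
    using hat_exists[OF k' k] by blast
  obtain \<mu> where \<mu>: "\<mu> > 0" "\<And>f. lumped h sm sp f \<phi> = \<mu> * f (p (Suc k))"
    using lumped_hat[OF k' k \<phi>(2)] by blast
  have u: "u \<in> piecewise_affine p n" using step by (simp add: parabolic_step_def Vh_eq)
  have "L2_inner (deriv u) (deriv (\<lambda>x. w x * \<phi> x)) =
     (\<Sum>j<n. (if j = k then piece_slope p u k * w (p (Suc k)) else 0) -
        (if j = Suc k then piece_slope p u (Suc k) * w (p (Suc k)) else 0))"
    unfolding L2_inner_deriv_product[OF u w \<phi>(1)] by (intro sum.cong) (auto simp: \<phi>(2))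
  also have "\<dots> = w (p (Suc k)) * (piece_slope p u k - piece_slope p u (Suc k))"
    using k by (simp add: sum_subtractf algebra_simps)
  finally have L2: "L2_inner (deriv u) (deriv (\<lambda>x. w x * \<phi> x)) =
    w (p (Suc k)) * (piece_slope p u k - piece_slope p u (Suc k))" .
  have "lumped h sm sp u \<phi> + \<tau> * L2_inner (deriv u) (deriv (\<lambda>x. w x * \<phi> x))
        = lumped h sm sp w \<phi>
          + m * q * \<tau> * lumped h sm sp (interp h sm sp (\<lambda>x. w x powr q * u x)) \<phi>
          + m * (1 - q) * \<tau> * lumped h sm sp (interp h sm sp (\<lambda>x. w x powr (q + 1))) \<phi>"
    using step \<phi>(1) by (simp add: parabolic_step_def Vh_eq)
  hence "\<mu> * u (p (Suc k)) + \<tau> * w (p (Suc k)) * (piece_slope p u k - piece_slope p u (Suc k)) =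
     \<mu> * (w (p (Suc k)) + m * q * \<tau> * (w (p (Suc k)) powr q * u (p (Suc k))) + m * (1 - q) * \<tau> * w (p (Suc k)) powr (q + 1))"
    unfolding L2 \<mu>(2) interp_node[OF k' k] by (simp add: algebra_simps)
  thus ?thesis using that \<mu>(1) by blast
qed

text \<open>Slope times cell length is a nodal increment. The end slopes fit
  \<open>piece_slope\<close> because \<open>u\<close> vanishes at \<open>- sm\<close> and
  \<open>sp\<close>.\<close>

lemma L1_norm_vh_le:
  assumes u: "u \<in> piecewise_affine p n"
  shows "L1_norm (vh h sm sp u) \<le> nodal_variation p n u"
proof -
  have u0: "u (p 0) = 0" "u (p n) = 0" using u by (auto simp: piecewise_affine_def)
  have vh: "vh h sm sp u x = (\<Sum>j<n. piece_slope p u j * indicator {p j<..<p (Suc j)} x)" for x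
  proof -
    have "slope_left h sm u = piece_slope p u 0"
      using u0 mesh_simps(1,3) by (simp add: slope_left_def piece_slope_def end_lengths)
    moreover have "slope_right h sp u = piece_slope p u (n - 1)"
      using u0 mesh_simps(2,4) n_ge_2 by (simp add: slope_right_def piece_slope_def end_lengths)
    moreover have "(\<Sum>i = a + 1..b. slope h u i * indicator {node h (i - 1)<..<node h i} x) =
      (\<Sum>j = 1..<n - 1. piece_slope p u j * indicator {p j<..<p (Suc j)} x)"
      unfolding sum_inner_cells
    proof (intro sum.cong refl)
      fix j assume "j \<in> {1..<n - 1}"
      hence j: "0 < j" "Suc j < n" by auto
      hence "p j = node h (a + int j - 1)" "p (Suc j) = node h (a + int j)" by (simp_all add: mesh_simps(5))
      thus "slope h u (a + int j) * indicator {node h (a + int j - 1)<..<node h (a + int j)} x =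
        piece_slope p u j * indicator {p j<..<p (Suc j)} x"
        using mesh_step[OF j] by (simp add: slope_def piece_slope_def)
    qed
    ultimately show ?thesis
      unfolding vh_def sum_cells[of "\<lambda>j. piece_slope p u j * indicator {p j<..<p (Suc j)} x"]
      using mesh_simps(1-4) n_ge_2 by simp
  qed
  have int: "integrable lborel (\<lambda>z. c * indicator {x<..<y} z :: real)" for c x y :: real
    by (intro integrable_mult_right integrable_real_indicator) (cases "x \<le> y"; simp)+
  have "L1_norm (vh h sm sp u) \<le> (LINT x|lborel. (\<Sum>j<n. \<bar>piece_slope p u j\<bar> * indicator {p j<..<p (Suc j)} x))"
    unfolding L1_norm_def vh
  proof (rule integral_mono)
    fix x
    have "\<bar>\<Sum>j<n. piece_slope p u j * indicator {p j<..<p (Suc j)} x\<bar> \<le>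
      (\<Sum>j<n. \<bar>piece_slope p u j * indicator {p j<..<p (Suc j)} x\<bar>)" by (rule sum_abs)
    thus "\<bar>\<Sum>j<n. piece_slope p u j * indicator {p j<..<p (Suc j)} x\<bar> \<le>
      (\<Sum>j<n. \<bar>piece_slope p u j\<bar> * indicator {p j<..<p (Suc j)} x)" by (simp add: abs_mult)
  qed (intro integrable_abs Bochner_Integration.integrable_sum int)+
  also have "\<dots> = (\<Sum>j<n. \<bar>piece_slope p u j\<bar> * (p (Suc j) - p j))"
    by (subst Bochner_Integration.integral_sum) (use int less[of _ "Suc _"] in \<open>auto intro!: sum.cong simp: less_imp_le\<close>)
  also have "\<dots> = nodal_variation p n u"
    unfolding nodal_variation_def
  proof (intro sum.cong refl)
    fix j assume "j \<in> {..<n}"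
    hence "p j < p (Suc j)" using less by simp
    thus "\<bar>piece_slope p u j\<bar> * (p (Suc j) - p j) = \<bar>u (p (Suc j)) - u (p j)\<bar>"
      by (simp add: piece_slope_def)
  qed
  finally show ?thesis .
qed

end

section \<open>The reaction map\<close>

text \<open>The new nodal value that the parabolic step would produce without its diffusion term:
  the solution \<open>g\<close> of \<open>g = w + m * q * \<tau> * w powr q * g + m * (1 - q) *
  \<tau> * w powr (q + 1)\<close>.\<close>

definition reaction :: "real \<Rightarrow> real \<Rightarrow> real \<Rightarrow> real \<Rightarrow> real" where
  "reaction m q \<tau> w = w * (1 + m * (1 - q) * \<tau> * w powr q) / (1 - m * q * \<tau> * w powr q)"

lemma reaction_0: "reaction m q \<tau> 0 = 0"
  by (simp add: reaction_def)

text \<open>Follows from \<open>ln (1 - x) \<le> - x\<close> and \<open>1 + t \<le> exp t\<close>.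
  It turns the rational growth factors into powers of a single quantity, which can then be
  multiplied over the time steps.\<close>

lemma bernoulli_powr_minus:
  fixes x s :: real
  assumes "0 \<le> x" "x < 1" "0 \<le> s"
  shows "1 + s * x \<le> (1 - x) powr - s"
proof -
  have "ln (1 - x) \<le> - x" using ln_le_minus_one[of "1 - x"] assms by simp
  hence "s * ln (1 - x) \<le> s * (- x)" using assms by (intro mult_left_mono) auto
  hence "1 + s * x \<le> 1 + - s * ln (1 - x)" by simp
  also have "\<dots> \<le> exp (- s * ln (1 - x))" by (rule exp_ge_add_one_self)
  finally show ?thesis using assms by (simp add: powr_def)
qed

text \<open>The factor \<open>x\<close> compensates the infinite slope of \<open>powr q\<close> at
  0. Monotonicity of \<open>powr (1 - q)\<close> gives
  \<open>x * y powr q \<le> y * x powr q\<close>, which bounds the left side by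
  \<open>x powr q * (y - x)\<close>.\<close>

lemma mult_powr_diff_le:
  fixes x y q :: real
  assumes "0 \<le> x" "x \<le> y" "0 < q" "q < 1"
  shows "x * (y powr q - x powr q) \<le> y powr q * (y - x)"
proof (cases "x = 0")
  case False
  hence pos: "0 < x" "0 < y" using assms by auto
  have "x powr (1 - q) \<le> y powr (1 - q)" using assms by (intro powr_mono2) auto
  hence "x powr (1 - q) * (x powr q * y powr q) \<le> y powr (1 - q) * (x powr q * y powr q)"
    by (intro mult_right_mono) auto
  moreover have "x powr (1 - q) * x powr q = x" "y powr (1 - q) * y powr q = y"
    using pos by (simp_all add: powr_add[symmetric])
  ultimately have "x * y powr q \<le> y * x powr q" by (metis mult.assoc mult.commute)
  moreover have "x powr q \<le> y powr q" using assms by (intro powr_mono2) auto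
  hence "x powr q * (y - x) \<le> y powr q * (y - x)" using assms by (intro mult_right_mono) auto
  ultimately show ?thesis by (simp add: algebra_simps)
qed (use assms in simp)

locale reaction_step =
  fixes m q \<tau> M :: real
  assumes m: "m > 0" and q: "0 < q" "q < 1" and \<tau>: "\<tau> > 0" and M: "M \<ge> 0"
    and small: "m * q * \<tau> * M powr q < 1"
begin

lemma powr_bound: "0 \<le> w \<Longrightarrow> w \<le> M \<Longrightarrow> m * q * \<tau> * w powr q \<le> m * q * \<tau> * M powr q"
  using m q \<tau> by (intro mult_left_mono powr_mono2) auto

lemma denominator_pos: "0 \<le> w \<Longrightarrow> w \<le> M \<Longrightarrow> 0 < 1 - m * q * \<tau> * w powr q"
  using powr_bound small by fastforce

lemma reaction_nonneg: "0 \<le> w \<Longrightarrow> w \<le> M \<Longrightarrow> 0 \<le> reaction m q \<tau> w"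
  using denominator_pos[of w] m q \<tau> by (simp add: reaction_def)

text \<open>Write the map as \<open>x * k X\<close> and split the difference into
  \<open>k Y * (y - x)\<close> and \<open>x * (k Y - k X)\<close>. Both are nonnegative, and in the
  second one \<open>mult_powr_diff_le\<close> replaces a Lipschitz bound for the power.\<close>

lemma reaction_lipschitz_mono:
  assumes "0 \<le> x" "x \<le> y" "y \<le> M"
  shows "reaction m q \<tau> x \<le> reaction m q \<tau> y"
    and "reaction m q \<tau> y - reaction m q \<tau> x \<le> (1 - m * q * \<tau> * M powr q) powr (- 2 / q) * (y - x)"
proof -
  define A where "A = m * \<tau> * M powr q"
  define X where "X = m * \<tau> * x powr q"
  define Y where "Y = m * \<tau> * y powr q"
  define k where "k z = (1 + (1 - q) * z) / (1 - q * z)" for z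
  have order: "0 \<le> X" "X \<le> Y" "Y \<le> A"
    using assms m q \<tau> by (auto simp: X_def Y_def A_def intro!: mult_left_mono powr_mono2)
  have qA: "q * A < 1" using small by (simp add: A_def mult_ac)
  have "q * Y \<le> q * A" "q * X \<le> q * Y" using order q by (auto intro: mult_left_mono)
  hence den: "1 - q * A > 0" "1 - q * X > 0" "1 - q * Y > 0" "1 - q * Y \<ge> 1 - q * A" "1 - q * X \<ge> 1 - q * A"
    using qA by auto
  have g: "reaction m q \<tau> x = x * k X" "reaction m q \<tau> y = y * k Y"
    by (simp_all add: reaction_def k_def X_def Y_def mult_ac)
  have diff: "k Y - k X = (Y - X) / ((1 - q * Y) * (1 - q * X))"
    using den by (simp add: k_def field_simps)
  have "reaction m q \<tau> y - reaction m q \<tau> x = k Y * (y - x) + x * (k Y - k X)"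
    by (simp add: g algebra_simps)
  hence *: "reaction m q \<tau> y - reaction m q \<tau> x = k Y * (y - x) + x * (Y - X) / ((1 - q * Y) * (1 - q * X))"
    by (simp only: diff times_divide_eq_right)
  have "0 \<le> k Y"
    unfolding k_def using order den(1-3) q by (intro divide_nonneg_pos add_nonneg_nonneg mult_nonneg_nonneg) auto
  hence "0 \<le> k Y * (y - x)" using assms by simp
  moreover have "0 \<le> x * (Y - X) / ((1 - q * Y) * (1 - q * X))"
    using assms order den(1-3) by (intro divide_nonneg_pos mult_nonneg_nonneg mult_pos_pos) auto
  ultimately show "reaction m q \<tau> x \<le> reaction m q \<tau> y" using * by linarith
  have "x * (Y - X) = m * \<tau> * (x * (y powr q - x powr q))"
    by (simp add: X_def Y_def algebra_simps)
  also have "\<dots> \<le> m * \<tau> * (y powr q * (y - x))"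
    using mult_powr_diff_le[of x y q] assms q m \<tau> by (intro mult_left_mono) auto
  also have "\<dots> = Y * (y - x)" by (simp add: Y_def)
  also have "\<dots> \<le> A * (y - x)" using order assms by (intro mult_right_mono) auto
  finally have "x * (Y - X) \<le> A * (y - x)" .
  moreover have "(1 - q * A) * (1 - q * A) \<le> (1 - q * Y) * (1 - q * X)"
    using den(1-3) order q by (intro mult_mono) auto
  moreover have "0 \<le> A * (y - x)" using order assms by simp
  ultimately have "x * (Y - X) / ((1 - q * Y) * (1 - q * X)) \<le> A * (y - x) / ((1 - q * A) * (1 - q * A))"
    using den(1) by (intro frac_le) auto
  moreover have "k Y \<le> k A"
    unfolding k_def using order q den(1-3) by (intro frac_le add_mono mult_left_mono) auto
  hence "k Y * (y - x) \<le> k A * (y - x)" using assms by (intro mult_right_mono) auto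
  ultimately have "reaction m q \<tau> y - reaction m q \<tau> x \<le> k A * (y - x) + A * (y - x) / ((1 - q * A) * (1 - q * A))"
    using * by linarith
  also have "\<dots> = (((1 + (1 - q) * A) * (1 - q * A) + A) * (1 - q * A) powr (-2)) * (y - x)"
  proof -
    have "B / D * c + A * c / (D * D) = ((B * D + A) * D powr (-2)) * c" if "D > 0" for B D c :: real
      using that by (simp add: powr_minus powr_numeral power2_eq_square field_simps)
    thus ?thesis using den(1) by (simp only: k_def)
  qed
  \<comment> \<open>The numerator is at most \<open>1 + s * (q * A)\<close> for
    \<open>s = 2 * (1 - q) / q\<close>. This \<open>s\<close> together with the exponent 2 of the
    denominator adds up to \<open>2 / q\<close>.\<close>
  also have "\<dots> \<le> ((1 - q * A) powr - (2 * (1 - q) / q) * (1 - q * A) powr (-2)) * (y - x)"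
  proof (intro mult_right_mono)
    have "(1 + (1 - q) * A) * (1 - q * A) + A = 1 + 2 * (1 - q) * A - q * (1 - q) * A^2"
      by (simp add: algebra_simps power2_eq_square)
    also have "\<dots> \<le> 1 + (2 * (1 - q) / q) * (q * A)"
      using q by simp
    also have "\<dots> \<le> (1 - q * A) powr - (2 * (1 - q) / q)"
      using order q qA by (intro bernoulli_powr_minus) auto
    finally show "(1 + (1 - q) * A) * (1 - q * A) + A \<le> (1 - q * A) powr - (2 * (1 - q) / q)" .
  qed (use assms in auto)
  also have "(1 - q * A) powr - (2 * (1 - q) / q) * (1 - q * A) powr (-2) = (1 - q * A) powr (- 2 / q)"
    unfolding powr_add[symmetric] using q by (simp add: field_simps)
  finally show "reaction m q \<tau> y - reaction m q \<tau> x \<le> (1 - m * q * \<tau> * M powr q) powr (- 2 / q) * (y - x)"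
    by (simp add: A_def mult_ac)
qed

lemma reaction_lipschitz:
  assumes "x \<in> {0..M}" "y \<in> {0..M}"
  shows "\<bar>reaction m q \<tau> y - reaction m q \<tau> x\<bar> \<le> (1 - m * q * \<tau> * M powr q) powr (- 2 / q) * \<bar>y - x\<bar>"
  using reaction_lipschitz_mono[of x y] reaction_lipschitz_mono[of y x] assms
  by (cases "x \<le> y") auto

text \<open>The right side is the exact solution at time \<open>\<tau>\<close> of
  \<open>y' = m * y powr (q + 1)\<close> started at \<open>M\<close>; the discrete reaction does not
  overshoot it. Bernoulli's inequality is used with \<open>s = (1 - q) / q\<close>.\<close>

lemma reaction_le: "reaction m q \<tau> M \<le> M * (1 - m * q * \<tau> * M powr q) powr (- 1 / q)"
proof -
  define x where "x = m * q * \<tau> * M powr q"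
  have x: "0 \<le> x" "x < 1" using small m q \<tau> by (auto simp: x_def)
  have "1 + m * (1 - q) * \<tau> * M powr q = 1 + ((1 - q) / q) * x"
    using q by (simp add: x_def)
  also have "\<dots> \<le> (1 - x) powr - ((1 - q) / q)"
    using x q by (intro bernoulli_powr_minus) auto
  finally have "(1 + m * (1 - q) * \<tau> * M powr q) / (1 - x) \<le> (1 - x) powr - ((1 - q) / q) / (1 - x)"
    using x by (intro divide_right_mono) auto
  also have "\<dots> = (1 - x) powr - ((1 - q) / q) * (1 - x) powr - 1"
    using x by (simp add: powr_minus divide_inverse)
  also have "\<dots> = (1 - x) powr (- 1 / q)"
    unfolding powr_add[symmetric] using q by (simp add: field_simps)
  finally have "M * ((1 + m * (1 - q) * \<tau> * M powr q) / (1 - x)) \<le> M * (1 - x) powr (- 1 / q)"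
    using M by (intro mult_left_mono)
  thus ?thesis by (simp add: reaction_def x_def)
qed

text \<open>Clearing the positive denominator of \<open>reaction\<close> turns the nodal equation
  into \<open>\<mu> * E = \<tau> * w * (s' - s)\<close>, so the jump of the slopes decides on which
  side of the reaction value \<open>u\<close> lies.\<close>

lemma reaction_compare:
  assumes w: "0 \<le> w" "w \<le> M" and "\<mu> > 0"
    and eq: "\<mu> * u + \<tau> * w * (s - s') = \<mu> * (w + m * q * \<tau> * (w powr q * u) + m * (1 - q) * \<tau> * w powr (q + 1))"
  shows "s' \<le> s \<Longrightarrow> u \<le> reaction m q \<tau> w" "s \<le> s' \<Longrightarrow> reaction m q \<tau> w \<le> u"
proof -
  define E where "E = u * (1 - m * q * \<tau> * w powr q) - w * (1 + m * (1 - q) * \<tau> * w powr q)"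
  have powr: "w powr (q + 1) = w powr q * w" using w by (simp add: powr_add)
  have E: "\<mu> * E = \<tau> * w * (s' - s)"
    using eq unfolding powr E_def by (simp add: algebra_simps)
  have den: "0 < 1 - m * q * \<tau> * w powr q" using denominator_pos w by simp
  show "u \<le> reaction m q \<tau> w" if "s' \<le> s"
  proof -
    have "\<mu> * E \<le> 0" unfolding E using that w \<tau> by (intro mult_nonneg_nonpos) auto
    hence "E \<le> 0" using \<open>\<mu> > 0\<close> by (simp add: mult_le_0_iff)
    thus ?thesis using den by (simp add: reaction_def E_def le_divide_eq)
  qed
  show "reaction m q \<tau> w \<le> u" if "s \<le> s'"
  proof -
    have "\<mu> * E \<ge> 0" unfolding E using that w \<tau> by (intro mult_nonneg_nonneg) auto
    hence "E \<ge> 0" using \<open>\<mu> > 0\<close> by (simp add: zero_le_mult_iff)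
    thus ?thesis using den by (simp add: reaction_def E_def divide_le_eq)
  qed
qed

end

section \<open>One step of the scheme\<close>

lemma finite_arg_max_obtain:
  fixes f :: "nat \<Rightarrow> real"
  obtains i where "i \<le> n" "\<And>j. j \<le> n \<Longrightarrow> f j \<le> f i"
proof -
  have "Max (f ` {..n}) \<in> f ` {..n}" by (intro Max_in) auto
  then obtain i where i: "i \<le> n" "Max (f ` {..n}) = f i" by (metis atMost_iff imageE)
  have "f j \<le> f i" if "j \<le> n" for j
    unfolding i(2)[symmetric] using that by (intro Max_ge) auto
  thus ?thesis using that i by blast
qed

context mesh_level
begin

lemma hyperbolic_step:
  assumes m: "m > 0" and \<tau>: "\<tau> > 0" and cont: "continuous_on UNIV u"
    and u: "\<And>x. 0 \<le> u x \<and> u x \<le> M" and supp: "\<And>x. x \<notin> {c<..<d} \<Longrightarrow> u x = 0"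
    and V: "\<And>(z :: nat \<Rightarrow> real) k. (\<And>i. i < k \<Longrightarrow> z i \<le> z (Suc i)) \<Longrightarrow> (\<Sum>i<k. \<bar>u (z (Suc i)) - u (z i)\<bar>) \<le> V"
  defines "w \<equiv> interp h sm sp (hopf_lax m \<tau> u)"
  shows "\<And>j. 0 \<le> w (p j) \<and> w (p j) \<le> M" and "nodal_variation p n w \<le> V"
proof -
  define F where "F = hopf_lax m \<tau> u"
  define \<rho> where "\<rho> = 1 + 4 * \<tau> / m * M"
  have M: "M \<ge> 0" using u[of 0] by linarith
  hence \<rho>: "\<rho> \<ge> 1" using m \<tau> by (simp add: \<rho>_def)
  have uM: "u x \<le> M" for x using u by blast
  note F_bounds = hopf_lax_bounds[OF m \<tau> cont uM]
  have w_in: "w \<in> piecewise_affine p n" unfolding w_def by (rule interp_in)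
  have w_ends: "w (p 0) = 0" "w (p n) = 0" using w_in by (auto simp: piecewise_affine_def)
  have w_node: "w (p j) = F (p j)" if "0 < j" "j < n" for j
    using that interp_node by (simp add: w_def F_def)
  have "0 \<le> w (p j) \<and> w (p j) \<le> M" if "j \<le> n" for j
  proof -
    consider "j = 0" | "0 < j" "j < n" | "j = n" using \<open>j \<le> n\<close> by linarith
    thus ?thesis
    proof cases
      case 2
      thus ?thesis using w_node F_bounds[of "p j"] u[of "p j"] by (simp add: F_def)
    qed (use w_ends M in auto)
  qed
  thus "0 \<le> w (p j) \<and> w (p j) \<le> M" for j
    using piecewise_affine_convex[OF w_in] by blast
  \<comment> \<open>The interpolant is 0 at the mesh ends, but \<open>F\<close> is not known to
    vanish there. The end points are therefore moved out by \<open>\<rho>\<close>, to places where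
    \<open>F\<close> and \<open>u\<close> are both 0, and the sampled values still agree with those
    of \<open>w\<close>.\<close>
  define L where "L = min (- sm) c - \<rho>"
  define R where "R = max sp d + \<rho>"
  define p' where "p' j = (if j = 0 then L else if j = n then R else p j)" for j
  have n0: "n \<noteq> 0" using n_ge_2 by simp
  have LR: "F L = 0" "F R = 0"
    unfolding F_def using \<rho> by (auto intro!: hopf_lax_eq_0_outside[OF m \<tau> cont uM supp, folded \<rho>_def] simp: L_def R_def)
  have uLR: "u L = 0" "u R = 0" using \<rho> by (auto intro!: supp simp: L_def R_def)
  have w_eq: "w (p j) = F (p' j)" if "j \<le> n" for j
    using that w_node[of j] w_ends LR by (auto simp: p'_def)
  have "(\<Sum>j<n. \<bar>F (p' (Suc j)) - F (p' j)\<bar>) \<le> V"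
    unfolding F_def
  proof (rule hopf_lax_variation[OF m \<tau> cont uM])
    show "strict_mono_on {..n} p'"
    proof (rule strict_mono_onI)
      fix i j assume ij: "i \<in> {..n}" "j \<in> {..n}" "i < j"
      have "p' i \<le> p i" using ij \<rho> mesh_simps(1) by (auto simp: p'_def L_def)
      also have "p i < p j" using ij less by simp
      also have "p j \<le> p' j" using ij \<rho> mesh_simps(2) by (auto simp: p'_def R_def)
      finally show "p' i < p' j" .
    qed
    show "hopf_lax m \<tau> u (p' 0) = u (p' 0)" "hopf_lax m \<tau> u (p' n) = u (p' n)"
      using LR uLR n0 by (auto simp: p'_def F_def)
  qed (use V in blast)
  moreover have "nodal_variation p n w = (\<Sum>j<n. \<bar>F (p' (Suc j)) - F (p' j)\<bar>)"
    unfolding nodal_variation_def by (intro sum.cong) (auto simp: w_eq)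
  ultimately show "nodal_variation p n w \<le> V" by simp
qed

text \<open>At an extremum the adjacent slopes have opposite weak signs, so
  \<open>reaction_compare\<close> applies. Global extrema give the bounds on \<open>u\<close>; the
  local ones feed \<open>variation_comparison\<close> against the reaction values of
  \<open>w\<close>, which by \<open>reaction_0\<close> also vanish at both ends.\<close>

lemma parabolic_step_bounds:
  assumes "reaction_step m q \<tau> M" and step: "parabolic_step m q \<tau> h sm sp w u"
    and w: "w \<in> piecewise_affine p n" and wM: "\<And>j. 0 \<le> w (p j) \<and> w (p j) \<le> M"
  shows "u \<in> piecewise_affine p n"
    and "0 \<le> u x \<and> u x \<le> M * (1 - m * q * \<tau> * M powr q) powr (- 1 / q)"
    and "nodal_variation p n u \<le> (1 - m * q * \<tau> * M powr q) powr (- 2 / q) * nodal_variation p n w"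
proof -
  interpret reaction_step m q \<tau> M by fact
  let ?g = "reaction m q \<tau>"
  show u: "u \<in> piecewise_affine p n" using step by (simp add: parabolic_step_def Vh_eq)
  have ends: "u (p 0) = 0" "u (p n) = 0" "w (p 0) = 0" "w (p n) = 0"
    using u w by (auto simp: piecewise_affine_def)
  have local_max: "u (p (Suc k)) \<le> ?g (w (p (Suc k)))"
    if k: "Suc k < n" and that: "u (p k) \<le> u (p (Suc k))" "u (p (Suc (Suc k))) \<le> u (p (Suc k))" for k
  proof -
    have "piece_slope p u (Suc k) \<le> 0" "0 \<le> piece_slope p u k"
      using k that less[of k "Suc k"] less[of "Suc k" "Suc (Suc k)"]
      by (auto simp: piece_slope_def intro: divide_nonpos_pos)
    moreover obtain \<mu> where "\<mu> > 0"
      "\<mu> * u (p (Suc k)) + \<tau> * w (p (Suc k)) * (piece_slope p u k - piece_slope p u (Suc k)) =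
       \<mu> * (w (p (Suc k)) + m * q * \<tau> * (w (p (Suc k)) powr q * u (p (Suc k))) + m * (1 - q) * \<tau> * w (p (Suc k)) powr (q + 1))"
      using parabolic_step_node[OF step w k] by blast
    ultimately show ?thesis using reaction_compare(1) wM by (meson order_trans)
  qed
  have local_min: "?g (w (p (Suc k))) \<le> u (p (Suc k))"
    if k: "Suc k < n" and that: "u (p (Suc k)) \<le> u (p k)" "u (p (Suc k)) \<le> u (p (Suc (Suc k)))" for k
  proof -
    have "piece_slope p u k \<le> 0" "0 \<le> piece_slope p u (Suc k)"
      using k that less[of k "Suc k"] less[of "Suc k" "Suc (Suc k)"]
      by (auto simp: piece_slope_def intro: divide_nonpos_pos)
    moreover obtain \<mu> where "\<mu> > 0"
      "\<mu> * u (p (Suc k)) + \<tau> * w (p (Suc k)) * (piece_slope p u k - piece_slope p u (Suc k)) =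
       \<mu> * (w (p (Suc k)) + m * q * \<tau> * (w (p (Suc k)) powr q * u (p (Suc k))) + m * (1 - q) * \<tau> * w (p (Suc k)) powr (q + 1))"
      using parabolic_step_node[OF step w k] by blast
    ultimately show ?thesis using reaction_compare(2) wM by (meson order_trans)
  qed
  let ?M' = "M * (1 - m * q * \<tau> * M powr q) powr (- 1 / q)"
  have M': "0 \<le> ?M'" using M by simp
  obtain i where i: "i \<le> n" "\<And>j. j \<le> n \<Longrightarrow> u (p j) \<le> u (p i)"
    using finite_arg_max_obtain[of n "\<lambda>j. u (p j)"] by blast
  have "u (p i) \<le> ?M'"
  proof (cases "i = 0 \<or> i = n")
    case False
    then obtain k where k: "i = Suc k" "Suc k < n" using i by (cases i) auto
    have "u (p i) \<le> ?g (w (p i))" unfolding k(1)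
      using i k by (intro local_max) auto
    also have "\<dots> \<le> ?g M" using wM M by (intro reaction_lipschitz_mono(1)) auto
    finally show ?thesis using reaction_le by linarith
  qed (use ends M' in auto)
  hence upper: "u (p j) \<le> ?M'" if "j \<le> n" for j using i that by (meson order_trans)
  \<comment> \<open>A global minimum yields nonnegativity of the new level, which
    \<open>parabolic_step\<close> does not include.\<close>
  obtain i where i: "i \<le> n" "\<And>j. j \<le> n \<Longrightarrow> u (p i) \<le> u (p j)"
    using finite_arg_max_obtain[of n "\<lambda>j. - u (p j)"] by auto
  have "0 \<le> u (p i)"
  proof (cases "i = 0 \<or> i = n")
    case False
    then obtain k where k: "i = Suc k" "Suc k < n" using i by (cases i) auto
    have "0 \<le> ?g (w (p i))" using wM by (intro reaction_nonneg) auto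
    also have "\<dots> \<le> u (p i)" unfolding k(1)
      using i k by (intro local_min) auto
    finally show ?thesis .
  qed (use ends in auto)
  hence "0 \<le> u (p j)" if "j \<le> n" for j using i that by (meson order_trans)
  thus "0 \<le> u x \<and> u x \<le> ?M'"
    using upper piecewise_affine_convex[OF u, of 0 ?M' x] by blast
  have "nodal_variation p n u \<le> (\<Sum>j<n. \<bar>?g (w (p (Suc j))) - ?g (w (p j))\<bar>)"
    unfolding nodal_variation_def
    by (rule variation_comparison) (auto simp: ends reaction_0 intro: local_max local_min)
  also have "\<dots> \<le> (\<Sum>j<n. (1 - m * q * \<tau> * M powr q) powr (- 2 / q) * \<bar>w (p (Suc j)) - w (p j)\<bar>)"
    using wM by (intro sum_mono reaction_lipschitz) auto
  finally show "nodal_variation p n u \<le> (1 - m * q * \<tau> * M powr q) powr (- 2 / q) * nodal_variation p n w"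
    by (simp add: nodal_variation_def sum_distrib_left)
qed

end

lemma scheme_step:
  assumes level: "mesh_level h sm sp" and reac: "reaction_step m q \<tau> M"
    and u: "u \<in> piecewise_affine (mesh h sm sp) (mesh_size h sm sp)" and uM: "\<And>x. 0 \<le> u x \<and> u x \<le> M"
    and sp': "sp' = sp - \<tau> / m * slope_right h sp u" and sm': "sm' = sm + \<tau> / m * slope_left h sm u"
    and step: "parabolic_step m q \<tau> h sm' sp' (interp h sm' sp' (hopf_lax m \<tau> u)) u'"
  shows "mesh_level h sm' sp'"
    and "u' \<in> piecewise_affine (mesh h sm' sp') (mesh_size h sm' sp')"
    and "0 \<le> u' x \<and> u' x \<le> M * (1 - m * q * \<tau> * M powr q) powr (- 1 / q)"
    and "nodal_variation (mesh h sm' sp') (mesh_size h sm' sp') u' \<le>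
      (1 - m * q * \<tau> * M powr q) powr (- 2 / q) * nodal_variation (mesh h sm sp) (mesh_size h sm sp) u"
proof -
  interpret reaction_step m q \<tau> M by fact
  interpret old: mesh_level h sm sp by fact
  \<comment> \<open>Nonnegativity of \<open>u\<close> fixes the signs of the end slopes, so the
    interval can only grow and stays admissible for \<open>mesh_level\<close>.\<close>
  have "slope_right h sp u \<le> 0" "0 \<le> slope_left h sm u"
    using uM old.end_length_pos[of sp] old.end_length_pos[of sm]
    by (auto simp: slope_right_def slope_left_def less_imp_le)
  hence "\<tau> / m * slope_right h sp u \<le> 0" "0 \<le> \<tau> / m * slope_left h sm u"
    using m \<tau> by (auto intro!: mult_nonneg_nonpos mult_nonneg_nonneg simp del: times_divide_eq_left)
  hence "sm \<le> sm'" "sp \<le> sp'" unfolding sp' sm' by auto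
  thus level': "mesh_level h sm' sp'" using old.h_pos old.h_le by unfold_locales auto
  interpret new: mesh_level h sm' sp' by fact
  have cont: "continuous_on UNIV u" and supp: "\<And>x. x \<notin> {old.p 0<..<old.p old.n} \<Longrightarrow> u x = 0"
    using u by (auto simp: piecewise_affine_def)
  note w = new.hyperbolic_step[OF m \<tau> cont uM supp old.variation_le_nodal_variation[OF u]]
  note bounds = new.parabolic_step_bounds[OF reac step new.interp_in w(1)]
  show "u' \<in> piecewise_affine (mesh h sm' sp') (mesh_size h sm' sp')"
    "0 \<le> u' x \<and> u' x \<le> M * (1 - m * q * \<tau> * M powr q) powr (- 1 / q)"
    using bounds(1,2) by auto
  note bounds(3)
  also have "(1 - m * q * \<tau> * M powr q) powr (- 2 / q) *
      nodal_variation new.p new.n (interp h sm' sp' (hopf_lax m \<tau> u)) \<le>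
    (1 - m * q * \<tau> * M powr q) powr (- 2 / q) * nodal_variation old.p old.n u"
    using w(2) by (intro mult_left_mono) auto
  finally show "nodal_variation new.p new.n u' \<le>
      (1 - m * q * \<tau> * M powr q) powr (- 2 / q) * nodal_variation old.p old.n u" .
qed

section \<open>Iteration\<close>

text \<open>One run of the scheme up to level \<open>l\<close>. For \<open>M0\<close> the sup norm
  of a nonzero initial interpolant, \<open>1 / B\<close> is the time \<open>T1\<close>.\<close>

locale scheme =
  fixes m q h s0 B M0 :: real and u0 :: "real \<Rightarrow> real" and \<tau> sm sp :: "nat \<Rightarrow> real"
    and u :: "nat \<Rightarrow> real \<Rightarrow> real" and l :: nat
  assumes m: "m > 0" and q: "0 < q" "q < 1" and h: "0 < h" "h \<le> s0" and u0: "\<And>x. 0 \<le> u0 x"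
    and solution: "numerical_solution m q s0 u0 h \<tau> sm sp u l"
    and M0: "\<And>x. interp h s0 s0 u0 x \<le> M0"
    and B: "B = m * q * M0 powr q" and before_blowup: "B * time \<tau> l < 1"
begin

abbreviation "variation k \<equiv> nodal_variation (mesh h (sm k) (sp k)) (mesh_size h (sm k) (sp k)) (u k)"

lemma B_nonneg: "0 \<le> B"
  using m q by (simp add: B)

lemma step_pos: "k < l \<Longrightarrow> \<tau> k > 0"
  using solution by (simp add: numerical_solution_def)

lemma remaining_pos: "k \<le> l \<Longrightarrow> 0 < 1 - B * time \<tau> k"
proof -
  assume "k \<le> l"
  hence "time \<tau> k \<le> time \<tau> l"
    unfolding time_def by (intro sum_mono2) (auto intro: less_imp_le step_pos)
  hence "B * time \<tau> k \<le> B * time \<tau> l" using B_nonneg by (rule mult_left_mono)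
  thus ?thesis using before_blowup by simp
qed

lemma M0_nonneg: "0 \<le> M0"
proof -
  interpret mesh_level h s0 s0 using h by unfold_locales auto
  have "interp h s0 s0 u0 s0 = 0" using interp_in by (auto simp: piecewise_affine_def mesh_simps)
  thus ?thesis using M0[of s0] by simp
qed

text \<open>The four facts go through the induction together: the first two allow the next step to
  be analysed, and the sup bound keeps the denominator of \<open>reaction\<close> positive
  there.\<close>

lemma bounds:
  assumes "k \<le> l"
  shows "mesh_level h (sm k) (sp k) \<and>
    u k \<in> piecewise_affine (mesh h (sm k) (sp k)) (mesh_size h (sm k) (sp k)) \<and>
    (\<forall>x. 0 \<le> u k x \<and> u k x \<le> M0 * (1 - B * time \<tau> k) powr (- 1 / q)) \<and>
    variation k \<le> variation 0 * (1 - B * time \<tau> k) powr (- 2 / q)"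
  using assms
proof (induction k)
  case 0
  have init: "sm 0 = s0" "sp 0 = s0" "u 0 = interp h s0 s0 u0"
    using solution by (simp_all add: numerical_solution_def)
  have level: "mesh_level h s0 s0" using h by unfold_locales auto
  interpret mesh_level h s0 s0 by fact
  define f where "f = interp h s0 s0 u0"
  have f: "f \<in> piecewise_affine p n" unfolding f_def by (rule interp_in)
  have "0 \<le> f (p j) \<and> f (p j) \<le> M0" if "j \<le> n" for j
  proof -
    consider "j = 0" | "0 < j" "j < n" | "j = n" using \<open>j \<le> n\<close> by linarith
    thus ?thesis
    proof cases
      case 2
      thus ?thesis using interp_node[of j u0] u0[of "p j"] M0[of "p j"] by (simp add: f_def)
    qed (use f M0_nonneg in \<open>auto simp: piecewise_affine_def\<close>)
  qed
  hence "0 \<le> f x \<and> f x \<le> M0" for x using piecewise_affine_convex[OF f, of 0 M0 x] by blast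
  thus ?case using level f by (simp add: init f_def[symmetric] time_def)
next
  case (Suc k)
  define D where "D = 1 - B * time \<tau> k"
  define D' where "D' = 1 - B * time \<tau> (Suc k)"
  have D: "0 < D" "0 < D'" using remaining_pos Suc.prems by (simp_all add: D_def D'_def)
  have D': "D' = D - B * \<tau> k" by (simp add: D_def D'_def time_def algebra_simps)
  have k: "k < l" and IH: "mesh_level h (sm k) (sp k)"
    "u k \<in> piecewise_affine (mesh h (sm k) (sp k)) (mesh_size h (sm k) (sp k))"
    "\<And>x. 0 \<le> u k x \<and> u k x \<le> M0 * D powr (- 1 / q)"
    "variation k \<le> variation 0 * D powr (- 2 / q)"
    using Suc by (auto simp: D_def)
  have "(M0 * D powr (- 1 / q)) powr q = M0 powr q * D powr (- 1)"
    using M0_nonneg q by (simp add: powr_mult powr_powr)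
  hence "m * q * \<tau> k * (M0 * D powr (- 1 / q)) powr q = B * \<tau> k / D"
    using D by (simp add: B powr_minus divide_inverse)
  \<comment> \<open>The power \<open>- 1 / q\<close> in the sup bound is undone by
    \<open>powr q\<close>, so the growth base of this step is a quotient of consecutive remaining
    factors and the product telescopes.\<close>
  hence ratio: "1 - m * q * \<tau> k * (M0 * D powr (- 1 / q)) powr q = D' / D"
    using D by (simp add: D' diff_divide_distrib)
  have reac: "reaction_step m q (\<tau> k) (M0 * D powr (- 1 / q))"
  proof
    have "0 < D' / D" using D by simp
    thus "m * q * \<tau> k * (M0 * D powr (- 1 / q)) powr q < 1" using ratio by linarith
  qed (use m q step_pos[OF k] M0_nonneg in auto)
  have step: "sp (Suc k) = sp k - \<tau> k / m * slope_right h (sp k) (u k)"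
    "sm (Suc k) = sm k + \<tau> k / m * slope_left h (sm k) (u k)"
    "parabolic_step m q (\<tau> k) h (sm (Suc k)) (sp (Suc k))
      (interp h (sm (Suc k)) (sp (Suc k)) (hopf_lax m (\<tau> k) (u k))) (u (Suc k))"
    using solution k by (auto simp: numerical_solution_def)
  note next_level = scheme_step[OF IH(1) reac IH(2,3) step, unfolded ratio]
  have cancel: "D powr r * (D' / D) powr r = D' powr r" for r
    using D by (simp add: powr_divide)
  have "variation (Suc k) \<le> (D' / D) powr (- 2 / q) * variation k" by (rule next_level(4))
  also have "\<dots> \<le> (D' / D) powr (- 2 / q) * (variation 0 * D powr (- 2 / q))"
    using IH(4) by (intro mult_left_mono) auto
  also have "\<dots> = variation 0 * (D powr (- 2 / q) * (D' / D) powr (- 2 / q))" by (simp only: mult_ac)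
  also have "\<dots> = variation 0 * D' powr (- 2 / q)" by (simp only: cancel)
  finally have "variation (Suc k) \<le> variation 0 * D' powr (- 2 / q)" .
  moreover have "0 \<le> u (Suc k) x \<and> u (Suc k) x \<le> M0 * D' powr (- 1 / q)" for x
    using next_level(3)[of x] by (simp only: mult.assoc cancel)
  ultimately show ?case using next_level(1,2) by (simp add: D'_def)
qed

lemma L1_norm_bound:
  "L1_norm (vh h (sm l) (sp l) (u l)) \<le>
    nodal_variation (mesh h s0 s0) (mesh_size h s0 s0) (interp h s0 s0 u0) * (1 - B * time \<tau> l) powr (- 2 / q)"
proof -
  interpret mesh_level h "sm l" "sp l" using bounds[of l] by simp
  have "L1_norm (vh h (sm l) (sp l) (u l)) \<le> variation l" using bounds[of l] L1_norm_vh_le by simp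
  also have "\<dots> \<le> variation 0 * (1 - B * time \<tau> l) powr (- 2 / q)" using bounds[of l] by simp
  finally show ?thesis using solution by (simp add: numerical_solution_def)
qed

end

section \<open>From a single run to bounds for all runs\<close>

text \<open>For continuous \<open>f\<close> the set where \<open>\<bar>f\<bar>\<close> exceeds a
  level above the essential supremum is open and null, hence empty.\<close>

lemma abs_le_Linf_norm:
  assumes cont: "continuous_on UNIV f" and bdd: "\<And>x. \<bar>f x\<bar> \<le> K"
  shows "\<bar>f x\<bar> \<le> Linf_norm f"
proof -
  let ?e = "esssup lborel (\<lambda>x. ereal \<bar>f x\<bar>)"
  have meas: "(\<lambda>x. ereal \<bar>f x\<bar>) \<in> borel_measurable lborel"
    using borel_measurable_continuous_onI[OF cont] by measurable
  have le: "?e \<le> ereal K" using bdd by (intro esssup_I[OF meas]) auto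
  have "ereal \<bar>f x\<bar> \<le> ?e"
  proof (rule ccontr)
    assume "\<not> ereal \<bar>f x\<bar> \<le> ?e"
    then obtain r where r: "?e < ereal r" "r < \<bar>f x\<bar>"
      by (metis ereal_dense2 ereal_less_ereal_Ex less_ereal.simps(1) linorder_not_le)
    define S where "S = {y. r < \<bar>f y\<bar>}"
    have "open S" unfolding S_def using cont by (intro open_Collect_less continuous_intros) auto
    moreover have "S \<in> null_sets lborel"
    proof -
      have "AE y in lborel. ereal \<bar>f y\<bar> \<le> ?e" by (rule esssup_AE)
      hence "AE y in lborel. y \<notin> S"
        by eventually_elim (use r in \<open>auto simp: S_def dest: le_less_trans\<close>)
      thus ?thesis using \<open>open S\<close> by (subst AE_iff_null_sets) auto
    qed
    ultimately have "S = {}"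
      using open_not_negligible[of S] by (auto simp: negligible_iff_null_sets intro: null_sets_completionI)
    thus False using r by (auto simp: S_def)
  qed
  \<comment> \<open>Finiteness makes the conversion of the essential supremum to a real number
    faithful.\<close>
  moreover from this have "\<bar>?e\<bar> \<noteq> \<infinity>" using le by (cases ?e) auto
  ultimately show ?thesis unfolding Linf_norm_def by (metis ereal_less_eq(3) ereal_real)
qed

text \<open>Here \<open>d\<close> is a lower bound for the remaining factor
  \<open>1 - B * time \<tau> n\<close>. The resulting constant depends on the mesh only through
  \<open>V\<close> and \<open>d\<close>.\<close>

lemma variation_bound_before_T1:
  assumes "m > 0" "0 < q" "q < 1" "0 < h" "h \<le> s0" "\<And>x. 0 \<le> u0 x"
    and V: "nodal_variation (mesh h s0 s0) (mesh_size h s0 s0) (interp h s0 s0 u0) \<le> V"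
    and d: "0 < d" "m * q * Linf_norm (interp h s0 s0 u0) powr q * T \<le> 1 - d"
  shows "variation_bound m q s0 u0 h T (V * d powr (- 2 / q))"
  unfolding variation_bound_def
proof (intro allI impI)
  fix \<tau> sm sp u n
  assume sol: "numerical_solution m q s0 u0 h \<tau> sm sp u n" and T: "time \<tau> n < T"
  define f where "f = interp h s0 s0 u0"
  interpret mesh_level h s0 s0 using assms by unfold_locales auto
  have f: "f \<in> piecewise_affine p (mesh_size h s0 s0)" unfolding f_def by (rule interp_in)
  \<comment> \<open>Any bound for \<open>f\<close> will do; it only certifies that the essential
    supremum is finite.\<close>
  define K where "K = Max ((\<lambda>j. \<bar>f (p j)\<bar>) ` {..mesh_size h s0 s0})"
  have "\<bar>f (p j)\<bar> \<le> K" if "j \<le> mesh_size h s0 s0" for j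
    unfolding K_def using that by (intro Max_ge) auto
  hence "- K \<le> f (p j) \<and> f (p j) \<le> K" if "j \<le> mesh_size h s0 s0" for j
    using that by (simp add: abs_le_iff minus_le_iff)
  hence "- K \<le> f x \<and> f x \<le> K" for x using piecewise_affine_convex[OF f, of "- K" K x] by blast
  hence "\<bar>f x\<bar> \<le> K" for x by (simp add: abs_le_iff minus_le_iff)
  moreover have "continuous_on UNIV f" using f by (simp add: piecewise_affine_def)
  ultimately have f_le: "f x \<le> Linf_norm f" for x using abs_le_Linf_norm[of f K x] by auto
  define B where "B = m * q * Linf_norm f powr q"
  have "B * time \<tau> n \<le> B * T" using T assms by (intro mult_left_mono) (auto simp: B_def)
  hence d': "d \<le> 1 - B * time \<tau> n" using d by (simp add: B_def f_def)
  interpret scheme m q h s0 B "Linf_norm f" u0 \<tau> sm sp u n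
    by unfold_locales (use assms sol f_le d d' in \<open>auto simp: B_def f_def\<close>)
  let ?V0 = "nodal_variation (mesh h s0 s0) (mesh_size h s0 s0) (interp h s0 s0 u0)"
  have V0: "0 \<le> ?V0" by (auto simp: nodal_variation_def intro: sum_nonneg)
  have "(1 - B * time \<tau> n) powr (- 2 / q) \<le> d powr (- 2 / q)"
    using d d' assms by (intro powr_mono2') auto
  hence "?V0 * (1 - B * time \<tau> n) powr (- 2 / q) \<le> V * d powr (- 2 / q)"
    using V V0 by (intro mult_mono) auto
  thus "L1_norm (vh h (sm n) (sp n) (u n)) \<le> V * d powr (- 2 / q)"
    using L1_norm_bound by linarith
qed

text \<open>Times are nonnegative, so no level lies before \<open>T\<close>. This leaves only
  positive \<open>T\<close> for \<open>T1_gap\<close>.\<close>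

lemma variation_bound_trivial:
  assumes "T \<le> 0"
  shows "variation_bound m q s0 u0 h T C"
proof -
  have "0 \<le> time \<tau> n" if "numerical_solution m q s0 u0 h \<tau> sm sp u n" for \<tau> sm sp u n
    using that by (auto simp: time_def numerical_solution_def intro!: sum_nonneg intro: less_imp_le)
  thus ?thesis using assms unfolding variation_bound_def by fastforce
qed

lemma interp_variation_le:
  assumes "0 < h" "h \<le> s0" and u0: "\<And>x. x \<notin> {-s0..s0} \<Longrightarrow> u0 x = 0"
    and V: "\<And>(p :: nat \<Rightarrow> real) k. mono p \<Longrightarrow> (\<Sum>i<k. \<bar>u0 (p (Suc i)) - u0 (p i)\<bar>) \<le> V"
  shows "nodal_variation (mesh h s0 s0) (mesh_size h s0 s0) (interp h s0 s0 u0) \<le> V"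
proof -
  interpret mesh_level h s0 s0 using assms by unfold_locales auto
  \<comment> \<open>The end nodes are moved strictly outside the support, where \<open>u0\<close> is
    0 as the interpolant is at its ends.\<close>
  define p' where "p' j = (if j = 0 then - s0 - 1 else if j < n then p j else s0 + 1)" for j
  have n0: "0 < n" using n_ge_2 by simp
  have "mono p'"
  proof (rule monoI)
    fix i j :: nat assume "i \<le> j"
    show "p' i \<le> p' j"
    proof (cases "j < n")
      case True
      have "p' i \<le> p i" using \<open>i \<le> j\<close> True mesh_simps(1) by (auto simp: p'_def)
      also have "p i \<le> p j" using \<open>i \<le> j\<close> True le by simp
      finally show ?thesis using \<open>i \<le> j\<close> True by (auto simp: p'_def)
    next
      case False
      have "p i \<le> s0" if "i < n" using le[of i n] that mesh_simps(2) by simp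
      thus ?thesis using False n0 assms(1,2) by (auto simp: p'_def)
    qed
  qed
  have eq: "interp h s0 s0 u0 (p j) = u0 (p' j)" if "j \<le> n" for j
  proof -
    consider "j = 0" | "0 < j" "j < n" | "j = n" using \<open>j \<le> n\<close> by linarith
    thus ?thesis
    proof cases
      case 2
      thus ?thesis by (simp add: interp_node p'_def)
    next
      case 1
      moreover have "interp h s0 s0 u0 (p 0) = 0" using interp_in by (auto simp: piecewise_affine_def)
      ultimately show ?thesis by (simp add: p'_def u0)
    next
      case 3
      moreover have "interp h s0 s0 u0 (p n) = 0" using interp_in by (auto simp: piecewise_affine_def)
      ultimately show ?thesis using n0 by (simp add: p'_def u0)
    qed
  qed
  have "nodal_variation p n (interp h s0 s0 u0) = (\<Sum>j<n. \<bar>u0 (p' (Suc j)) - u0 (p' j)\<bar>)"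
    unfolding nodal_variation_def by (intro sum.cong) (auto simp: eq)
  thus ?thesis using V[OF \<open>mono p'\<close>] by simp
qed

text \<open>The gap \<open>d = 1 - T / S'\<close> is chosen before \<open>f\<close>, so it serves
  all meshes at once. A real \<open>S'\<close> is inserted between \<open>T\<close> and
  \<open>S\<close> because \<open>S\<close> may be infinite.\<close>

lemma T1_gap:
  assumes "m > 0" "0 < q" and T: "0 < T" and S: "ereal T < S"
  obtains d where "0 < d" "\<And>f. S \<le> T1 m q f \<Longrightarrow> m * q * Linf_norm f powr q * T \<le> 1 - d"
proof -
  have zero: "Linf_norm (\<lambda>x. 0) = 0"
    by (simp add: Linf_norm_def esssup_const)
  obtain S' where S': "T < S'" "ereal S' \<le> S"
    using S by (metis ereal_dense2 less_ereal.simps(1) less_imp_le)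
  have "m * q * Linf_norm f powr q * T \<le> 1 - (1 - T / S')" if "S \<le> T1 m q f" for f
  proof (cases "f = (\<lambda>x. 0)")
    case True
    thus ?thesis using T S' by (simp add: zero)
  next
    case False
    hence "S \<le> ereal (1 / (m * q * Linf_norm f powr q))" using that by (simp add: T1_def)
    with S'(2) have "ereal S' \<le> ereal (1 / (m * q * Linf_norm f powr q))" by (rule order_trans)
    hence "S' \<le> 1 / (m * q * Linf_norm f powr q)" by simp
    moreover define B where "B = m * q * Linf_norm f powr q"
    ultimately have *: "S' \<le> 1 / B" by simp
    \<comment> \<open>Division by 0 gives 0, so this also excludes the degenerate case
      \<open>B = 0\<close>.\<close>
    have "0 < 1 / B" using * S'(1) T by linarith
    hence "0 < B" by simp
    hence "B * S' \<le> 1" using * by (simp add: le_divide_eq mult.commute)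
    hence "B * S' * (T / S') \<le> 1 * (T / S')" using T S' by (intro mult_right_mono) auto
    thus ?thesis using T S' by (simp add: B_def)
  qed
  moreover have "0 < 1 - T / S'" using T S' by simp
  ultimately show ?thesis using that by blast
qed

text \<open>A constant common to all meshes needs a bound on the variation of the initial
  interpolants, supplied by bounded variation of \<open>u0\<close>, and a gap below blow-up that
  does not close as the mesh varies, supplied by \<open>S\<close>. In the second claim
  \<open>C\<close> may depend on the mesh, whose initial interpolant always has finite
  variation.\<close>

theorem lemma2p6:
  fixes m q s0 :: real and u0 :: "real \<Rightarrow> real"
  assumes "m > 0" and "0 < q" and "q < 1" and "s0 > 0"
    and "continuous_on UNIV u0" and "\<And>x. u0 x \<ge> 0"
    and "closure {x. u0 x \<noteq> 0} = {-s0..s0}"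
  shows "(bounded_variation u0 \<longrightarrow>
           (\<forall>(T :: real) (S :: ereal). ereal T < S \<longrightarrow>
             (\<exists>C. \<forall>N::nat. N \<ge> 1 \<longrightarrow> S \<le> T1 m q (interp (s0 / real N) s0 s0 u0) \<longrightarrow>
                variation_bound m q s0 u0 (s0 / real N) T C)))
       \<and> (\<forall>N::nat. N \<ge> 1 \<longrightarrow>
           (\<forall>T::real. ereal T < T1 m q (interp (s0 / real N) s0 s0 u0) \<longrightarrow>
             (\<exists>C. variation_bound m q s0 u0 (s0 / real N) T C)))"
proof (intro conjI impI allI)
  fix T S assume "bounded_variation u0" and S: "ereal T < S"
  then obtain V where V: "\<And>(p :: nat \<Rightarrow> real) k. mono p \<Longrightarrow> (\<Sum>i<k. \<bar>u0 (p (Suc i)) - u0 (p i)\<bar>) \<le> V"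
    unfolding bounded_variation_def by blast
  have supp: "u0 x = 0" if "x \<notin> {-s0..s0}" for x
    using that assms(7) closure_subset[of "{x. u0 x \<noteq> 0}"] by blast
  show "\<exists>C. \<forall>N::nat. N \<ge> 1 \<longrightarrow> S \<le> T1 m q (interp (s0 / real N) s0 s0 u0) \<longrightarrow>
    variation_bound m q s0 u0 (s0 / real N) T C"
  proof (cases "T \<le> 0")
    case False
    then obtain d where d: "0 < d" "\<And>f. S \<le> T1 m q f \<Longrightarrow> m * q * Linf_norm f powr q * T \<le> 1 - d"
      using T1_gap[of m q T S] assms(1,2) S by auto
    have "variation_bound m q s0 u0 (s0 / real N) T (V * d powr (- 2 / q))"
      if "N \<ge> 1" "S \<le> T1 m q (interp (s0 / real N) s0 s0 u0)" for N
    proof (rule variation_bound_before_T1[OF assms(1-3) _ _ assms(6) _ d(1) d(2)[OF that(2)]])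
      show h: "0 < s0 / real N" "s0 / real N \<le> s0" using that assms(4) by (auto simp: divide_le_eq)
      show "nodal_variation (mesh (s0 / real N) s0 s0) (mesh_size (s0 / real N) s0 s0)
          (interp (s0 / real N) s0 s0 u0) \<le> V"
        by (rule interp_variation_le[OF h supp V])
    qed
    thus ?thesis by blast
  qed (use variation_bound_trivial in blast)
next
  fix N :: nat and T assume N: "1 \<le> N" and T: "ereal T < T1 m q (interp (s0 / real N) s0 s0 u0)"
  have h: "0 < s0 / real N" "s0 / real N \<le> s0" using N assms(4) by (auto simp: divide_le_eq)
  show "\<exists>C. variation_bound m q s0 u0 (s0 / real N) T C"
  proof (cases "T \<le> 0")
    case False
    then obtain d where "0 < d" "m * q * Linf_norm (interp (s0 / real N) s0 s0 u0) powr q * T \<le> 1 - d"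
      using T1_gap[OF assms(1,2) _ T] by (metis linorder_not_le order_refl)
    \<comment> \<open>For a fixed mesh, \<open>V\<close> is the variation of the initial interpolant
      itself.\<close>
    thus ?thesis using variation_bound_before_T1[where ?u0.0 = u0, OF assms(1-3) h assms(6) order_refl] by blast
  qed (use variation_bound_trivial in blast)
qed

end
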